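(* There exist a countable group $G$, a continuous action of $G$ on the Baire space $\mathbb N^\mathbb N$ with orbit equivalence relation $F$, and a Baire class 2 bijection $\Phi\colon 2^\mathbb N\to\mathbb N^\mathbb N$ such that for all $x,y\in 2^\mathbb N$, $x\equiv_T y\iff\Phi(x)\,F\,\Phi(y)$.
   Context: $\equiv_T$ denotes Turing equivalence on $2^\mathbb N$: $x\equiv_T y$ iff each of $x,y$ is computable from the other. A map between Polish spaces is Baire class 2 if it is a pointwise limit of Baire class 1 maps (equivalently, preimages of open sets are $\mathbf\Sigma^0_3$). *)

theory Defs
  imports "HOL-Analysis.Analysis" "HOL-Algebra.Group_Action"
begin

text \<open>
  Kleene's schemata for partial recursive functions with an oracle. Arities are not tracked in the
  type: a term applied to argument lists of one fixed length \<open>n\<close> denotes an \<open>n\<close>-ary partial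
  function.
\<close>

datatype oracle_term =
    Zero
  | Succ
  | Proj nat
  | Oracle
  | Comp oracle_term "oracle_term list"
  | PrimRec oracle_term oracle_term
  | Mu oracle_term

text \<open>
  \<open>oracle_eval y t as v\<close>: the partial function denoted by \<open>t\<close>, with oracle the characteristic
  function of \<open>y\<close>, is defined at \<open>as\<close> with value \<open>v\<close>.
\<close>

inductive oracle_eval :: "(nat \<Rightarrow> bool) \<Rightarrow> oracle_term \<Rightarrow> nat list \<Rightarrow> nat \<Rightarrow> bool"
  for y :: "nat \<Rightarrow> bool" where
  Zero: "oracle_eval y Zero as 0"
| Succ: "oracle_eval y Succ [n] (Suc n)"
| Proj: "i < length as \<Longrightarrow> oracle_eval y (Proj i) as (as ! i)"
| Oracle: "oracle_eval y Oracle [n] (of_bool (y n))"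
| Comp: "list_all2 (\<lambda>g b. oracle_eval y g as b) gs bs \<Longrightarrow> oracle_eval y f bs v
    \<Longrightarrow> oracle_eval y (Comp f gs) as v"
| PrimRec_0: "oracle_eval y f as v \<Longrightarrow> oracle_eval y (PrimRec f g) (0 # as) v"
| PrimRec_Suc: "oracle_eval y (PrimRec f g) (n # as) u \<Longrightarrow> oracle_eval y g (n # u # as) v
    \<Longrightarrow> oracle_eval y (PrimRec f g) (Suc n # as) v"
| Mu: "oracle_eval y f (n # as) 0 \<Longrightarrow> \<forall>i<n. \<exists>u>0. oracle_eval y f (i # as) u
    \<Longrightarrow> oracle_eval y (Mu f) as n"

definition turing_reducible :: "(nat \<Rightarrow> bool) \<Rightarrow> (nat \<Rightarrow> bool) \<Rightarrow> bool" (infix "\<le>\<^sub>T" 50) where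
  "x \<le>\<^sub>T y \<longleftrightarrow> (\<exists>t. \<forall>n. oracle_eval y t [n] (of_bool (x n)))"

definition turing_equivalent :: "(nat \<Rightarrow> bool) \<Rightarrow> (nat \<Rightarrow> bool) \<Rightarrow> bool" (infix "\<equiv>\<^sub>T" 50) where
  "x \<equiv>\<^sub>T y \<longleftrightarrow> x \<le>\<^sub>T y \<and> y \<le>\<^sub>T x"

text \<open>
  Baire class 1 is taken in the sense of \<open>\<Sigma>\<^sup>0\<^sub>2\<close> preimages of open sets. For maps out of Cantor
  space this agrees with being a pointwise limit of continuous maps; for arbitrary Polish spaces
  only the former makes Baire class 2 equivalent to \<open>\<Sigma>\<^sup>0\<^sub>3\<close> preimages.
\<close>

definition baire_class_1 :: "('a::topological_space \<Rightarrow> 'b::topological_space) \<Rightarrow> bool" where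
  "baire_class_1 f \<longleftrightarrow> (\<forall>U. open U \<longrightarrow> fsigma_in euclidean (f -` U))"

definition baire_class_2 :: "('a::topological_space \<Rightarrow> 'b::topological_space) \<Rightarrow> bool" where
  "baire_class_2 f \<longleftrightarrow>
     (\<exists>g. (\<forall>n::nat. baire_class_1 (g n)) \<and> (\<forall>x. (\<lambda>n. g n x) \<longlonglongrightarrow> f x))"

text \<open>The acting group carries the discrete topology.\<close>

definition continuous_action ::
    "('g, 'm) monoid_scheme \<Rightarrow> ('g \<Rightarrow> 'a::topological_space \<Rightarrow> 'a) \<Rightarrow> bool" where
  "continuous_action G \<phi> \<longleftrightarrow>
     group_action G UNIV \<phi> \<and> (\<forall>g \<in> carrier G. continuous_on UNIV (\<phi> g))"

definition orbit_equiv :: "('g, 'm) monoid_scheme \<Rightarrow> ('g \<Rightarrow> 'a \<Rightarrow> 'a) \<Rightarrow> 'a \<Rightarrow> 'a \<Rightarrow> bool" where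
  "orbit_equiv G \<phi> a b \<longleftrightarrow> b \<in> orbit G \<phi> a"

end

theory Submission
  imports Defs
begin

text \<open>
  Turing equivalence is the union of the graphs of the partial maps \<open>x \<mapsto> s\<^sup>x\<close> with inverse
  \<open>y \<mapsto> t\<^sup>y\<close>, where \<open>s\<close> and \<open>t\<close> range over oracle programs; these are homeomorphisms between
  \<open>G\<^sub>\<delta>\<close> subsets of Cantor space. Close the family of their domains under preimages and under
  passing from a \<open>G\<^sub>\<delta>\<close> set to closed sets whose union is its complement.
  Declaring the resulting countably many \<open>G\<^sub>\<delta>\<close> sets clopen gives a finer zero-dimensional Polish
  topology in which the partial maps are homeomorphisms between clopen sets. Where such a map
  changes a given bit it can be completed by its inverse and the identity to a global involution,
  and these involutions generate the equivalence relation.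

  The finer topology has isolated points, since computable reals are singled out by programs.
  Remove the points with a countable neighbourhood together with a countable dense invariant set:
  the rest is homeomorphic to Baire space, and since all classes are countably infinite, the
  countably many removed classes can be put back in the manner of Hilbert's hotel. The latter
  changes the map only on a countable set and therefore preserves Baire class 2.
\<close>

section \<open>Cantor space and Baire space\<close>

definition agree :: "nat \<Rightarrow> (nat \<Rightarrow> 'a) \<Rightarrow> (nat \<Rightarrow> 'a) \<Rightarrow> bool" where
  "agree n x y \<longleftrightarrow> (\<forall>i<n. x i = y i)"

lemma agree_refl [simp]: "agree n x x"
  by (simp add: agree_def)

lemma agree_sym: "agree n x y \<Longrightarrow> agree n y x"
  by (simp add: agree_def)

lemma agree_trans: "agree n x y \<Longrightarrow> agree n y z \<Longrightarrow> agree n x z"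
  by (simp add: agree_def)

lemma agree_mono: "agree n x y \<Longrightarrow> m \<le> n \<Longrightarrow> agree m x y"
  by (simp add: agree_def)

lemma agree_iff_map: "agree n x y \<longleftrightarrow> map x [0..<n] = map y [0..<n]"
  by (auto simp: agree_def list_eq_iff_nth_eq)

lemma open_agree: "open {y :: nat \<Rightarrow> 'a::discrete_topology. agree n x y}"
proof -
  have "open {y :: nat \<Rightarrow> 'a. \<forall>i\<in>{..<n}. y (id i) \<in> {x i}}"
    by (rule product_topology_basis') (simp_all add: open_discrete)
  moreover have "{y. \<forall>i\<in>{..<n}. y (id i) \<in> {x i}} = {y. agree n x y}"
    by (auto simp: agree_def)
  ultimately show ?thesis by simp
qed

text \<open>A basic box constrains only finitely many coordinates, so a bound on those coordinates
  is a sufficient length of agreement.\<close>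

lemma open_iff_agree:
  fixes U :: "(nat \<Rightarrow> 'a::discrete_topology) set"
  shows "open U \<longleftrightarrow> (\<forall>x\<in>U. \<exists>n. \<forall>y. agree n x y \<longrightarrow> y \<in> U)"
proof
  assume U: "open U"
  show "\<forall>x\<in>U. \<exists>n. \<forall>y. agree n x y \<longrightarrow> y \<in> U"
  proof
    fix x assume "x \<in> U"
    from product_topology_open_contains_basis[OF U[unfolded open_fun_def] this]
    obtain X where X: "x \<in> (\<Pi>\<^sub>E i\<in>UNIV. X i)" "finite {i. X i \<noteq> UNIV}"
        "(\<Pi>\<^sub>E i\<in>UNIV. X i) \<subseteq> U"
      by (auto simp: topspace_euclidean)
    obtain n where n: "\<forall>i\<in>{i. X i \<noteq> UNIV}. i < n"
      using X(2) unfolding finite_nat_set_iff_bounded by blast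
    have "y \<in> U" if "agree n x y" for y
    proof -
      have "y i \<in> X i" for i
      proof (cases "X i = UNIV")
        case False
        with n that have "y i = x i" by (simp add: agree_def)
        with X(1) show ?thesis by (auto simp: PiE_iff)
      qed simp
      then show ?thesis using X(3) by (auto simp: PiE_iff)
    qed
    then show "\<exists>n. \<forall>y. agree n x y \<longrightarrow> y \<in> U" by blast
  qed
next
  assume *: "\<forall>x\<in>U. \<exists>n. \<forall>y. agree n x y \<longrightarrow> y \<in> U"
  show "open U"
  proof (rule topological_space_class.openI)
    fix x assume "x \<in> U"
    with * obtain n where "\<forall>y. agree n x y \<longrightarrow> y \<in> U" by blast
    then show "\<exists>T. open T \<and> x \<in> T \<and> T \<subseteq> U"
      by (intro exI[of _ "{y. agree n x y}"]) (auto simp: open_agree)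
  qed
qed

lemma closed_iff_agree:
  fixes C :: "(nat \<Rightarrow> 'a::discrete_topology) set"
  shows "closed C \<longleftrightarrow> (\<forall>x. (\<forall>n. \<exists>y\<in>C. agree n x y) \<longrightarrow> x \<in> C)"
  unfolding closed_def open_iff_agree Ball_def Bex_def Compl_iff by blast

lemma closed_agree: "closed {y :: nat \<Rightarrow> 'a::discrete_topology. agree n x y}"
  unfolding closed_iff_agree by (fastforce simp: agree_def)

lemma continuous_on_UNIV_iff_agree:
  fixes f :: "(nat \<Rightarrow> 'a::discrete_topology) \<Rightarrow> (nat \<Rightarrow> 'b::discrete_topology)"
  shows "continuous_on UNIV f \<longleftrightarrow> (\<forall>x k. \<exists>m. \<forall>y. agree m x y \<longrightarrow> agree k (f x) (f y))"
proof
  assume f: "continuous_on UNIV f"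
  show "\<forall>x k. \<exists>m. \<forall>y. agree m x y \<longrightarrow> agree k (f x) (f y)"
  proof (intro allI)
    fix x k
    have "open (f -` {z. agree k (f x) z})"
      using f open_agree by (metis continuous_on_open_vimage open_UNIV Int_UNIV_right)
    then show "\<exists>m. \<forall>y. agree m x y \<longrightarrow> agree k (f x) (f y)"
      unfolding open_iff_agree by auto
  qed
next
  assume *: "\<forall>x k. \<exists>m. \<forall>y. agree m x y \<longrightarrow> agree k (f x) (f y)"
  have "open (f -` B)" if "open B" for B
    unfolding open_iff_agree
  proof
    fix x assume "x \<in> f -` B"
    with that obtain k where k: "\<forall>z. agree k (f x) z \<longrightarrow> z \<in> B"
      unfolding open_iff_agree by auto
    obtain m where "\<forall>y. agree m x y \<longrightarrow> agree k (f x) (f y)" using * by blast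
    with k show "\<exists>n. \<forall>y. agree n x y \<longrightarrow> y \<in> f -` B" by auto
  qed
  then show "continuous_on UNIV f"
    by (simp add: continuous_on_open_vimage)
qed

text \<open>Over a countable alphabet there are only countably many finite sequences; each
  determines a clopen cylinder, and the cylinders inside \<open>U\<close> exhaust it.\<close>

lemma open_fun_countable_Union:
  fixes U :: "(nat \<Rightarrow> 'a::{discrete_topology,countable}) set"
  assumes "open U"
  obtains F :: "nat \<Rightarrow> (nat \<Rightarrow> 'a) set" where "\<And>n. open (F n)" "\<And>n. closed (F n)" "U = (\<Union>n. F n)"
proof -
  \<comment> \<open>A sequence whose cylinder is not contained in \<open>U\<close> contributes the
    empty set, so that all natural numbers can serve as indices.\<close>
  define F where "F n = (let s = from_nat n :: 'a list; C = {y. map y [0..<length s] = s} in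
      if C \<subseteq> U then C else {})" for n
  have cyl: "{y. map y [0..<length s] = s} = {y. agree (length s) (\<lambda>i. s ! i) y}" for s :: "'a list"
  proof (intro Collect_cong iffI)
    fix y assume s: "map y [0..<length s] = s"
    have "map y [0..<length s] ! i = y i" if "i < length s" for i
      using that by simp
    with s show "agree (length s) ((!) s) y" by (simp add: agree_def)
  next
    fix y assume "agree (length s) ((!) s) y"
    then show "map y [0..<length s] = s" by (intro nth_equalityI) (simp_all add: agree_def)
  qed
  have 1: "open (F n)" "closed (F n)" for n
    by (auto simp: F_def Let_def cyl open_agree closed_agree)
  have 2: "U = (\<Union>n. F n)"
  proof
    show "(\<Union>n. F n) \<subseteq> U" by (auto simp: F_def Let_def split: if_splits)
    show "U \<subseteq> (\<Union>n. F n)"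
    proof
      fix x assume "x \<in> U"
      then obtain k where k: "\<forall>y. agree k x y \<longrightarrow> y \<in> U"
        using assms unfolding open_iff_agree by blast
      have "x \<in> F (to_nat (map x [0..<k]))"
        using k by (auto simp: F_def Let_def agree_iff_map)
      then show "x \<in> (\<Union>n. F n)" by blast
    qed
  qed
  from 1 2 that show thesis by blast
qed

section \<open>F-sigma sets and a coordinatewise criterion for Baire class 1\<close>

lemma fsigma_in_UN:
  assumes "\<And>n::nat. fsigma_in X (F n)"
  shows "fsigma_in X (\<Union>n. F n)"
  by (rule fsigma_in_Union) (use assms in auto)

lemma fsigma_in_open_fun:
  fixes U :: "(nat \<Rightarrow> 'a::{discrete_topology,countable}) set"
  shows "open U \<Longrightarrow> fsigma_in euclidean U"
  by (erule open_fun_countable_Union) (simp add: fsigma_in_UN closed_imp_fsigma_in)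

text \<open>An open set is a countable union of cylinders, and the preimage of a cylinder is a
  finite intersection of sets of the assumed form.\<close>

lemma baire_class_1I:
  fixes g :: "'a::topological_space \<Rightarrow> nat \<Rightarrow> nat"
  assumes "\<And>i j. fsigma_in euclidean {x. g x i = j}"
  shows "baire_class_1 g"
  unfolding baire_class_1_def
proof (intro allI impI)
  fix U :: "(nat \<Rightarrow> nat) set" assume "open U"
  have cyl: "fsigma_in euclidean {x. agree k z (g x)}" for k z
  proof (induction k)
    case 0
    show ?case using fsigma_in_topspace[of "euclidean :: 'a topology"] by (simp add: agree_def)
  next
    case (Suc k)
    have "{x. agree (Suc k) z (g x)} = {x. agree k z (g x)} \<inter> {x. g x k = z k}"
      by (auto simp: agree_def less_Suc_eq)
    then show ?case using Suc assms by (simp add: fsigma_in_Int)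
  qed
  define C where "C = (\<lambda>s. {x. agree (length s) (\<lambda>i. s ! i) (g x)})"
  define D where "D = {s. \<forall>z. agree (length s) (\<lambda>i. s ! i) z \<longrightarrow> z \<in> U}"
  have "g -` U = \<Union> (C ` D)"
  proof
    show "\<Union> (C ` D) \<subseteq> g -` U" by (auto simp: C_def D_def)
    show "g -` U \<subseteq> \<Union> (C ` D)"
    proof
      fix x assume "x \<in> g -` U"
      then obtain k where k: "\<forall>y. agree k (g x) y \<longrightarrow> y \<in> U"
        using \<open>open U\<close> unfolding open_iff_agree by auto
      have "map (g x) [0..<k] \<in> D" "x \<in> C (map (g x) [0..<k])"
        using k by (auto simp: C_def D_def agree_def)
      then show "x \<in> \<Union> (C ` D)" by blast
    qed
  qed
  then show "fsigma_in euclidean (g -` U)"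
    using cyl by (auto intro!: fsigma_in_Union simp: C_def)
qed

lemma tendsto_fun_iff_agree:
  fixes x :: "nat \<Rightarrow> 'a::discrete_topology"
  shows "(y \<longlongrightarrow> x) F \<longleftrightarrow> (\<forall>n. eventually (\<lambda>k. agree n x (y k)) F)"
proof
  assume y: "(y \<longlongrightarrow> x) F"
  show "\<forall>n. eventually (\<lambda>k. agree n x (y k)) F"
    using topological_tendstoD[OF y open_agree, of _ x] by simp
next
  assume *: "\<forall>n. eventually (\<lambda>k. agree n x (y k)) F"
  show "(y \<longlongrightarrow> x) F"
  proof (rule topological_tendstoI)
    fix S assume "open S" "x \<in> S"
    then obtain n where n: "\<forall>z. agree n x z \<longrightarrow> z \<in> S"
      unfolding open_iff_agree by blast
    show "eventually (\<lambda>k. y k \<in> S) F"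
      using *[rule_format, of n] by (rule eventually_mono) (use n in blast)
  qed
qed

lemma eventually_agreeI:
  assumes "\<And>i. eventually (\<lambda>k. x i = y k i) F"
  shows "eventually (\<lambda>k. agree n x (y k)) F"
  using eventually_ball_finite[of "{..<n}" "\<lambda>k i. x i = y k i" F] assms
  by (simp add: agree_def Ball_def)

text \<open>The form in which continuity for the refined topology is used later, with
  \<open>h\<close> as \<open>refine\<close>: finitely many finitely decided properties are decided
  together by the longest of the initial segments.\<close>

lemma agree_combine:
  fixes h :: "'b \<Rightarrow> nat \<Rightarrow> 'a" and n :: nat
  assumes "\<And>i. i < n \<Longrightarrow> \<exists>k. \<forall>y. agree k a (h y) \<longrightarrow> P i y"
  shows "\<exists>k. \<forall>y. agree k a (h y) \<longrightarrow> (\<forall>i<n. P i y)"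
  using assms
proof (induction n)
  case (Suc n)
  then obtain k where k: "\<forall>y. agree k a (h y) \<longrightarrow> (\<forall>i<n. P i y)" by (meson less_SucI)
  obtain l where l: "\<forall>y. agree l a (h y) \<longrightarrow> P n y" using Suc.prems by blast
  have "\<forall>y. agree (max k l) a (h y) \<longrightarrow> (\<forall>i<Suc n. P i y)"
    using k l agree_mono[of "max k l" a _ k] agree_mono[of "max k l" a _ l]
    by (auto simp: less_Suc_eq)
  then show ?case by blast
qed simp

lemma clopen_bit: "open {x :: nat \<Rightarrow> bool. x n}" "closed {x :: nat \<Rightarrow> bool. x n}"
proof -
  show "open {x :: nat \<Rightarrow> bool. x n}"
    unfolding open_iff_agree by (auto simp: agree_def intro!: exI[of _ "Suc n"])
  have "open (- {x :: nat \<Rightarrow> bool. x n})"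
    unfolding open_iff_agree by (auto simp: agree_def intro!: exI[of _ "Suc n"])
  then show "closed {x :: nat \<Rightarrow> bool. x n}" by (simp add: closed_def)
qed

lemma closed_imp_gdelta_in_nat_bool: "closed S \<Longrightarrow> gdelta_in euclidean (S :: (nat \<Rightarrow> bool) set)"
  using fsigma_in_open_fun[OF open_Compl, of S] by (simp add: gdelta_in_fsigma_in Compl_eq_Diff_UNIV)

text \<open>The preimage of an open set is the trace on \<open>A\<close> of an open set;
  intersecting countably many traces with the G-delta set \<open>A\<close> stays G-delta.\<close>

lemma gdelta_in_continuous_preimage:
  fixes f :: "'a::topological_space \<Rightarrow> 'b::topological_space"
  assumes "gdelta_in euclidean A" "continuous_on A f" "gdelta_in euclidean S"
  shows "gdelta_in euclidean {x \<in> A. f x \<in> S}"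
proof -
  obtain C where C: "\<And>n. open (C n)" "S = (\<Inter>n::nat. C n)"
    using assms(3) unfolding gdelta_in_descending by auto
  have "\<exists>V. open V \<and> f -` C n \<inter> A = V \<inter> A" for n
    using continuous_on_open_invariant[THEN iffD1, OF assms(2)] C(1) by (metis (full_types))
  then obtain V where V: "\<And>n. open (V n)" "\<And>n. f -` C n \<inter> A = V n \<inter> A" by metis
  have "{x \<in> A. f x \<in> S} = A \<inter> (\<Inter>n. V n)"
    using V(2) C(2) by blast
  moreover have "gdelta_in euclidean (\<Inter>n. V n)"
    using V(1) by (intro gdelta_in_Inter) (auto intro: open_imp_gdelta_in)
  ultimately show ?thesis using assms(1) by (simp add: gdelta_in_Int)
qed

lemma uncountable_UNIV_nat_bool: "uncountable (UNIV :: (nat \<Rightarrow> bool) set)"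
proof
  assume "countable (UNIV :: (nat \<Rightarrow> bool) set)"
  then obtain g :: "nat \<Rightarrow> nat \<Rightarrow> bool" where "range g = UNIV"
    using uncountable_def by blast
  then obtain n where "g n = (\<lambda>k. \<not> g k k)" by (metis rangeE UNIV_I)
  then show False by (metis (full_types))
qed

text \<open>Large values mean that \<open>x\<close> is close to \<open>w\<close>. Used as an
  additional coordinate, this sends \<open>w\<close> to infinity. The value 0 at \<open>w\<close>
  itself is a default and is also taken at points that differ from \<open>w\<close> at once.\<close>

definition first_difference :: "(nat \<Rightarrow> 'a) \<Rightarrow> (nat \<Rightarrow> 'a) \<Rightarrow> nat" where
  "first_difference w x = (if x = w then 0 else (LEAST n. x n \<noteq> w n))"

lemma first_difference_neq: "x \<noteq> w \<Longrightarrow> x (first_difference w x) \<noteq> w (first_difference w x)"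
proof -
  assume "x \<noteq> w"
  then have "\<exists>n. x n \<noteq> w n" by blast
  from LeastI_ex[OF this] show ?thesis using \<open>x \<noteq> w\<close> by (simp add: first_difference_def)
qed

lemma first_difference_eqI:
  assumes "x n \<noteq> w n" "agree n w x"
  shows "first_difference w x = n"
proof -
  have "(LEAST n. x n \<noteq> w n) = n"
    using assms by (intro Least_equality) (auto simp: agree_def not_less[symmetric])
  then show ?thesis using assms(1) by (auto simp: first_difference_def)
qed

lemma agree_first_difference: "agree (first_difference w x) w x"
  unfolding first_difference_def agree_def by (auto dest: not_less_Least)

lemma first_difference_cong:
  assumes "x \<noteq> w" "agree (Suc (first_difference w x)) x y"
  shows "first_difference w y = first_difference w x"
proof (rule first_difference_eqI)
  show "y (first_difference w x) \<noteq> w (first_difference w x)"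
    using first_difference_neq[OF assms(1)] assms(2) by (simp add: agree_def)
  show "agree (first_difference w x) w y"
    using agree_first_difference[of w x] assms(2) by (simp add: agree_def)
qed

lemma first_difference_ge:
  assumes "x \<noteq> w" "agree n w x"
  shows "n \<le> first_difference w x"
  using first_difference_neq[OF assms(1)] assms(2) unfolding agree_def by (metis not_le)

lemma open_first_difference: "open {x :: nat \<Rightarrow> 'a::discrete_topology. x \<noteq> w \<and> first_difference w x = n}"
  unfolding open_iff_agree
proof
  fix x assume "x \<in> {x. x \<noteq> w \<and> first_difference w x = n}"
  then have x: "x \<noteq> w" "first_difference w x = n" by auto
  have "y \<in> {x. x \<noteq> w \<and> first_difference w x = n}" if "agree (Suc n) x y" for y
  proof -
    have "y n \<noteq> w n" using first_difference_neq[OF x(1)] x(2) that by (simp add: agree_def)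
    then show ?thesis using first_difference_cong[OF x(1), of y] x(2) that by auto
  qed
  then show "\<exists>k. \<forall>y. agree k x y \<longrightarrow> y \<in> {x. x \<noteq> w \<and> first_difference w x = n}" by blast
qed

lemma closed_singleton_fun: "closed {w :: nat \<Rightarrow> 'a::discrete_topology}"
  unfolding closed_iff_agree agree_def by (auto simp: fun_eq_iff)

lemma closed_finite_fun: "finite D \<Longrightarrow> closed (D :: (nat \<Rightarrow> 'a::discrete_topology) set)"
  by (induction rule: finite_induct) (use closed_Un[OF closed_singleton_fun] in auto)

lemma fsigma_in_first_difference:
  "fsigma_in euclidean {x :: nat \<Rightarrow> 'a::{discrete_topology,countable}. first_difference w x = n}"
proof -
  \<comment> \<open>Because of the default value, \<open>w\<close> lies in the level set of 0, which
    is why that set is not just the open one.\<close>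
  have "{x. first_difference w x = n} =
      {x. x \<noteq> w \<and> first_difference w x = n} \<union> (if n = 0 then {w} else {})"
    by (auto simp: first_difference_def)
  also have "fsigma_in euclidean \<dots>"
    by (rule fsigma_in_Un[OF fsigma_in_open_fun[OF open_first_difference]])
      (simp add: closed_imp_fsigma_in closed_singleton_fun)
  finally show ?thesis .
qed

section \<open>Infinitely branching trees\<close>

text \<open>
  Instead of splitting a node at the next level, we jump to the first level at which it has
  infinitely many extensions; enumerating these identifies the body of the tree with the full
  Baire space.
\<close>

context
  fixes L :: "(nat \<Rightarrow> nat) set"
begin

definition extensions :: "(nat \<Rightarrow> nat) \<Rightarrow> nat \<Rightarrow> nat \<Rightarrow> nat list set" where
  "extensions x k l = {map y [0..<l] |y. y \<in> L \<and> agree k x y}"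

text \<open>Starting from \<open>Suc k\<close> makes the levels strictly increasing for every
  \<open>x\<close>, also where no level with infinitely many extensions exists and the least one is
  unspecified.\<close>

definition split_level :: "(nat \<Rightarrow> nat) \<Rightarrow> nat \<Rightarrow> nat" where
  "split_level x k = Suc k + (LEAST d. infinite (extensions x k (Suc k + d)))"

primrec level :: "(nat \<Rightarrow> nat) \<Rightarrow> nat \<Rightarrow> nat" where
  "level x 0 = 0"
| "level x (Suc n) = split_level x (level x n)"

text \<open>On an infinite countable set \<open>to_nat_on\<close> is a bijection onto the natural
  numbers, so at a node of the tree every value is realized by exactly one extension.\<close>

definition unfold_tree :: "(nat \<Rightarrow> nat) \<Rightarrow> nat \<Rightarrow> nat" where
  "unfold_tree x n =
     to_nat_on (extensions x (level x n) (level x (Suc n))) (map x [0..<level x (Suc n)])"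

lemma countable_extensions: "countable (extensions x k l)"
  by (rule countableI_type)

lemma extensions_cong: "agree k x y \<Longrightarrow> extensions x k = extensions y k"
  unfolding extensions_def agree_def by (intro ext Collect_cong) auto

lemma split_level_cong: "agree k x y \<Longrightarrow> split_level x k = split_level y k"
  unfolding split_level_def by (simp add: extensions_cong)

lemma level_strict_mono: "strict_mono (level x)"
  by (rule strict_mono_Suc_iff[THEN iffD2]) (simp add: split_level_def)

lemma level_mono: "m \<le> n \<Longrightarrow> level x m \<le> level x n"
  using level_strict_mono by (simp add: strict_mono_less_eq)

lemma level_ge: "n \<le> level x n"
  using level_strict_mono by (rule strict_mono_imp_increasing)

text \<open>The next level depends only on the segment below the current one; hence agreement up to
  level number \<open>n\<close> also fixes level number \<open>Suc n\<close>.\<close>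

lemma level_cong: "agree (level x n) x y \<Longrightarrow> m \<le> Suc n \<Longrightarrow> level y m = level x m"
proof (induction m)
  case (Suc m)
  then have "agree (level x m) x y" by (intro agree_mono[OF Suc.prems(1)] level_mono) simp
  with Suc show ?case by (simp add: split_level_cong)
qed simp

lemma unfold_tree_cong:
  assumes "agree (level x (Suc n)) x y" "m \<le> n"
  shows "unfold_tree x m = unfold_tree y m"
proof -
  have "agree (level x (Suc m)) x y" "agree (level x m) x y"
    using assms by (auto intro!: agree_mono[OF assms(1)] level_mono simp del: level.simps)
  moreover have "level y m = level x m" "level y (Suc m) = level x (Suc m)"
    using \<open>agree (level x m) x y\<close> by (auto intro!: level_cong simp del: level.simps)
  ultimately show ?thesis
    unfolding unfold_tree_def
    by (simp add: agree_iff_map extensions_cong[OF \<open>agree (level x m) x y\<close>] del: level.simps map_eq_conv)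
qed

lemma continuous_unfold_tree: "continuous_on UNIV unfold_tree"
  unfolding continuous_on_UNIV_iff_agree
proof (intro allI)
  fix x k
  show "\<exists>m. \<forall>y. agree m x y \<longrightarrow> agree k (unfold_tree x) (unfold_tree y)"
    unfolding agree_def[of k]
    by (intro exI[of _ "level x (Suc k)"] allI impI unfold_tree_cong[where n = k]) (simp_all add: less_imp_le del: level.simps)
qed

text \<open>Agreement up to one level gives both points the same set of extensions, on which the
  numbering is injective; so an equal next value forces agreement up to the next level.\<close>

lemma agree_if_unfold_tree_agree:
  assumes "x \<in> L" "y \<in> L"
  shows "agree n (unfold_tree x) (unfold_tree y) \<Longrightarrow> agree (level x n) x y"
proof (induction n)
  case 0
  show ?case by (simp add: agree_def)
next
  case (Suc n)
  then have *: "agree (level x n) x y" using agree_mono by fastforce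
  then have lv: "level y n = level x n" "level y (Suc n) = level x (Suc n)"
    by (auto intro!: level_cong simp del: level.simps)
  let ?A = "extensions x (level x n) (level x (Suc n))"
  have "to_nat_on ?A (map x [0..<level x (Suc n)]) = to_nat_on ?A (map y [0..<level x (Suc n)])"
    using Suc.prems lv extensions_cong[OF *]
    by (simp add: unfold_tree_def agree_def less_Suc_eq del: level.simps)
  moreover have "map x [0..<level x (Suc n)] \<in> ?A" "map y [0..<level x (Suc n)] \<in> ?A"
    using assms * unfolding extensions_def by (auto simp del: level.simps)
  ultimately show ?case
    by (simp add: countable_extensions agree_iff_map del: level.simps)
qed

context
  assumes closed: "closed L" and nonempty: "L \<noteq> {}"
    and branching: "\<And>x k. x \<in> L \<Longrightarrow> \<exists>i. infinite {y i |y. y \<in> L \<and> agree k x y}"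
begin

text \<open>A coordinate \<open>i\<close> with infinitely many values produces infinitely many
  extensions at length \<open>Suc k + i\<close>, which exceeds \<open>i\<close>; thus the least
  level is a genuine one.\<close>

lemma infinite_extensions_split_level:
  assumes "x \<in> L"
  shows "infinite (extensions x k (split_level x k))"
proof -
  obtain i where i: "infinite {y i |y. y \<in> L \<and> agree k x y}"
    using branching[OF assms] by blast
  have "{y i |y. y \<in> L \<and> agree k x y} \<subseteq> (\<lambda>s. s ! i) ` extensions x k (Suc k + i)"
  proof
    fix v assume "v \<in> {y i |y. y \<in> L \<and> agree k x y}"
    then obtain y where "v = y i" "y \<in> L" "agree k x y" by blast
    then show "v \<in> (\<lambda>s. s ! i) ` extensions x k (Suc k + i)"
      unfolding extensions_def by (intro image_eqI[of _ _ "map y [0..<Suc k + i]"]) (auto simp del: upt_Suc)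
  qed
  with i have "infinite (extensions x k (Suc k + i))"
    using finite_surj by blast
  then show ?thesis unfolding split_level_def by (rule LeastI)
qed

lemma unfold_tree_extend:
  assumes "x \<in> L"
  obtains y where "y \<in> L" "agree (level x n) x y" "unfold_tree y n = v"
proof -
  let ?A = "extensions x (level x n) (level x (Suc n))"
  have "infinite ?A" using infinite_extensions_split_level[OF assms] by simp
  then obtain s where "s \<in> ?A" "to_nat_on ?A s = v"
    using to_nat_on_surj[OF countable_extensions] by blast
  then obtain y where y: "y \<in> L" "agree (level x n) x y" "s = map y [0..<level x (Suc n)]"
    unfolding extensions_def by blast
  have "level y n = level x n" "level y (Suc n) = level x (Suc n)"
    using y by (auto intro!: level_cong simp del: level.simps)
  then have "unfold_tree y n = v"
    using y \<open>to_nat_on ?A s = v\<close> extensions_cong[OF y(2)]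
    by (simp add: unfold_tree_def del: level.simps)
  with y that show thesis by blast
qed

text \<open>Prescribed values are realized one after another by members of \<open>L\<close>; each
  choice keeps the segment already fixed, and the limit is in \<open>L\<close> because
  \<open>L\<close> is closed.\<close>

lemma unfold_tree_surj: "\<exists>x\<in>L. unfold_tree x = v"
proof -
  have "\<exists>y. \<forall>n. (y n \<in> L \<and> agree n (unfold_tree (y n)) v) \<and> agree (level (y n) n) (y n) (y (Suc n))"
  proof (rule dependent_nat_choice)
    show "\<exists>x. x \<in> L \<and> agree 0 (unfold_tree x) v"
      using nonempty by (auto simp: agree_def)
  next
    fix x n assume x: "x \<in> L \<and> agree n (unfold_tree x) v"
    then obtain y where y: "y \<in> L" "agree (level x n) x y" "unfold_tree y n = v n"
      using unfold_tree_extend by blast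
    \<comment> \<open>Here \<open>n\<close> is positive, and agreement up to
      \<open>level x n\<close> preserves exactly the values with index at most
      \<open>n - 1\<close>.\<close>
    have "unfold_tree y i = v i" if "i < n" for i
      using unfold_tree_cong[of x "n - 1" y i] y(2) x that by (simp add: agree_def)
    then show "\<exists>y. (y \<in> L \<and> agree (Suc n) (unfold_tree y) v) \<and> agree (level x n) x y"
      using y by (auto simp: agree_def less_Suc_eq)
  qed
  then obtain y where y: "\<And>n. y n \<in> L" "\<And>n. agree n (unfold_tree (y n)) v"
      "\<And>n. agree (level (y n) n) (y n) (y (Suc n))"
    by blast
  have later: "agree (level (y n) n) (y n) (y (n + d))" for n d
  proof (induction d)
    case (Suc d)
    have "level (y (n + d)) n = level (y n) n"
      by (rule level_cong[OF Suc]) simp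
    then have "agree (level (y n) n) (y (n + d)) (y (Suc (n + d)))"
      by (metis agree_mono y(3) level_mono le_add1)
    with Suc show ?case by (auto intro: agree_trans)
  qed simp
  \<comment> \<open>Coordinate \<open>i\<close> is final from \<open>y (Suc i)\<close> on, since
    level number \<open>Suc i\<close> lies above \<open>i\<close>.\<close>
  define x where "x i = y (Suc i) i" for i
  have x: "agree (level (y n) n) (y n) x" for n
    unfolding agree_def x_def
  proof (intro allI impI)
    fix i assume i: "i < level (y n) n"
    show "y n i = y (Suc i) i"
    proof (cases "n \<le> Suc i")
      case True
      then show ?thesis using later[of n "Suc i - n"] i by (simp add: agree_def)
    next
      case False
      have "i < level (y (Suc i)) (Suc i)"
        using level_ge[of "Suc i" "y (Suc i)"] by (simp add: Suc_le_eq del: level.simps)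
      then show ?thesis using later[of "Suc i" "n - Suc i"] False
        by (simp add: agree_def del: level.simps)
    qed
  qed
  have "x \<in> L"
    using closed x y(1) unfolding closed_iff_agree by (metis agree_mono agree_sym level_ge)
  moreover have "unfold_tree x n = v n" for n
    using unfold_tree_cong[OF x[of "Suc n"], of n] y(2)[of "Suc n"] by (simp add: agree_def)
  ultimately show ?thesis by blast
qed

lemma bij_betw_unfold_tree: "bij_betw unfold_tree L UNIV"
proof -
  have "inj_on unfold_tree L"
  proof (rule inj_onI)
    fix x y assume "x \<in> L" "y \<in> L" "unfold_tree x = unfold_tree y"
    then have "agree n x y" for n
      using agree_if_unfold_tree_agree[of x y n] level_ge by (metis agree_mono agree_refl)
    then show "x = y" by (auto simp: agree_def fun_eq_iff)
  qed
  then show ?thesis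
    using unfold_tree_surj unfolding bij_betw_def by (auto simp: image_iff) metis
qed

end

end

text \<open>The last conclusion is a uniform form of continuity of the inverse. It holds because the
  level reached after \<open>n\<close> values is at least \<open>n\<close>.\<close>

theorem closed_infinitely_branching_imp_baire_space:
  fixes L :: "(nat \<Rightarrow> nat) set"
  assumes "closed L" "L \<noteq> {}"
    and "\<And>x k. x \<in> L \<Longrightarrow> \<exists>i. infinite {y i |y. y \<in> L \<and> agree k x y}"
  obtains \<Psi> :: "(nat \<Rightarrow> nat) \<Rightarrow> (nat \<Rightarrow> nat)"
  where "continuous_on UNIV \<Psi>" "bij_betw \<Psi> L UNIV"
    "\<And>x y n. x \<in> L \<Longrightarrow> y \<in> L \<Longrightarrow> agree n (\<Psi> x) (\<Psi> y) \<Longrightarrow> agree n x y"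
proof
  show "continuous_on UNIV (unfold_tree L)" by (rule continuous_unfold_tree)
  show "bij_betw (unfold_tree L) L UNIV" using assms by (rule bij_betw_unfold_tree)
  show "agree n x y" if "x \<in> L" "y \<in> L" "agree n (unfold_tree L x) (unfold_tree L y)" for x y n
    using agree_if_unfold_tree_agree[OF that] level_ge by (rule agree_mono)
qed

section \<open>Actions generated by involutions\<close>

lemma foldr_involutions_rev:
  assumes "\<And>i x. \<theta> i (\<theta> i x) = x"
  shows "foldr \<theta> (rev l) (foldr \<theta> l x) = x"
  by (induction l arbitrary: x) (simp_all add: assms)

text \<open>Words in the involutions are closed under composition by concatenation and under
  inverses by reversal. The group consists of the maps denoted by words, coded by natural
  numbers.\<close>

lemma continuous_action_of_involutions:
  fixes \<theta> :: "nat \<Rightarrow> 'a::topological_space \<Rightarrow> 'a"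
  assumes inv: "\<And>i x. \<theta> i (\<theta> i x) = x"
    and cont: "\<And>i. continuous_on UNIV (\<theta> i)"
  obtains G :: "nat monoid" and \<phi> :: "nat \<Rightarrow> 'a \<Rightarrow> 'a"
  where "group G" "continuous_action G \<phi>"
    "\<And>x y. orbit_equiv G \<phi> x y \<longleftrightarrow> (\<exists>l. y = foldr \<theta> l x)"
proof -
  define H where "H = range (foldr \<theta>)"
  have count: "countable H" unfolding H_def by simp
  have id: "id \<in> H" unfolding H_def by (auto simp: image_iff fun_eq_iff intro!: exI[of _ "[]"])
  have comp: "f \<circ> g \<in> H" if "f \<in> H" "g \<in> H" for f g
  proof -
    from that obtain l m where "f = foldr \<theta> l" "g = foldr \<theta> m" by (auto simp: H_def)
    then have "f \<circ> g = foldr \<theta> (l @ m)" by (simp add: fun_eq_iff)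
    then show ?thesis by (simp add: H_def)
  qed
  have inverse: "\<exists>g\<in>H. g \<circ> f = id \<and> f \<circ> g = id" if "f \<in> H" for f
  proof -
    from that obtain l where l: "f = foldr \<theta> l" by (auto simp: H_def)
    have "foldr \<theta> (rev l) \<circ> f = id" "f \<circ> foldr \<theta> (rev l) = id"
      using foldr_involutions_rev[of \<theta>, OF inv, of l] foldr_involutions_rev[of \<theta>, OF inv, of "rev l"]
      by (auto simp: l fun_eq_iff)
    then show ?thesis by (auto simp: H_def)
  qed
  have contH: "continuous_on UNIV f" if "f \<in> H" for f
  proof -
    from that obtain l where l: "f = foldr \<theta> l" by (auto simp: H_def)
    show ?thesis unfolding l
    proof (induction l)
      case Nil
      show ?case by (simp add: continuous_on_id)
    next
      case (Cons i l)
      then show ?case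
        using continuous_on_compose[OF Cons continuous_on_subset[OF cont[of i] subset_UNIV]]
        by simp
    qed
  qed
  define N where "N = to_nat_on H"
  define \<phi> where "\<phi> = from_nat_into H"
  have \<phi>N [simp]: "\<phi> (N f) = f" if "f \<in> H" for f
    using that count by (simp add: \<phi>_def N_def)
  \<comment> \<open>\<open>H\<close> may be finite, so the carrier is the set of codes of its
    members; there \<open>N\<close> and \<open>\<phi>\<close> are inverse to each other.\<close>
  define G :: "nat monoid" where "G = \<lparr>carrier = N ` H, mult = \<lambda>a b. N (\<phi> a \<circ> \<phi> b), one = N id\<rparr>"
  have carrier: "carrier G = N ` H" and mult: "a \<otimes>\<^bsub>G\<^esub> b = N (\<phi> a \<circ> \<phi> b)" and one: "\<one>\<^bsub>G\<^esub> = N id" for a b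
    by (simp_all add: G_def)
  have group: "group G"
  proof (rule groupI, unfold carrier mult one)
    fix a assume "a \<in> N ` H"
    then obtain f where f: "a = N f" "f \<in> H" by blast
    obtain g where "g \<in> H" "g \<circ> f = id" using inverse[OF f(2)] by blast
    then show "\<exists>b\<in>N ` H. N (\<phi> b \<circ> \<phi> a) = N id"
      using f by (intro bexI[of _ "N g"]) simp_all
  qed (auto simp: id comp o_assoc)
  have bij: "\<phi> a \<in> carrier (BijGroup UNIV)" if "a \<in> carrier G" for a
  proof -
    from that obtain f where f: "a = N f" "f \<in> H" unfolding carrier by blast
    obtain g where "g \<circ> f = id" "f \<circ> g = id" using inverse[OF f(2)] by blast
    then have "bij f" by (rule o_bij)
    then show ?thesis using f by (simp add: BijGroup_def Bij_def)
  qed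
  have "\<phi> (a \<otimes>\<^bsub>G\<^esub> b) = \<phi> a \<otimes>\<^bsub>BijGroup UNIV\<^esub> \<phi> b" if "a \<in> carrier G" "b \<in> carrier G" for a b
  proof -
    have "\<phi> a \<otimes>\<^bsub>BijGroup UNIV\<^esub> \<phi> b = \<phi> a \<circ> \<phi> b"
      using bij[OF that(1)] bij[OF that(2)] by (simp add: BijGroup_def compose_def comp_def restrict_UNIV)
    moreover have "\<phi> a \<circ> \<phi> b \<in> H"
      using that by (auto simp: carrier comp)
    ultimately show ?thesis by (simp add: mult)
  qed
  then have "\<phi> \<in> hom G (BijGroup UNIV)"
    using bij by (simp add: hom_def)
  then have "group_action G UNIV \<phi>"
    using group group_BijGroup
    by (simp add: group_action_def group_hom_def group_hom_axioms_def)
  then have "continuous_action G \<phi>"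
    using contH by (auto simp: continuous_action_def carrier)
  moreover have "orbit_equiv G \<phi> x y \<longleftrightarrow> (\<exists>l. y = foldr \<theta> l x)" for x y
  proof -
    have "orbit G \<phi> x = {f x |f. f \<in> H}"
      unfolding orbit_def carrier using \<phi>N by force
    then show ?thesis by (auto simp: orbit_equiv_def H_def)
  qed
  ultimately show thesis using group that by blast
qed

section \<open>Absorbing countably many classes\<close>

text \<open>Numbering the infinitely many classes, and the points inside each infinite class, gives
  coordinates in which the relation is equality of first components.\<close>

lemma countable_classes_enumeration:
  assumes E: "equivp E" and V: "countable V"
    and sat: "\<And>x y. x \<in> V \<Longrightarrow> E x y \<Longrightarrow> y \<in> V"
    and inf: "\<And>x. x \<in> V \<Longrightarrow> infinite (Collect (E x))"
    and many: "infinite ((\<lambda>x. Collect (E x)) ` V)"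
  obtains h :: "'a \<Rightarrow> nat \<times> nat"
  where "bij_betw h V UNIV" "\<And>x y. x \<in> V \<Longrightarrow> y \<in> V \<Longrightarrow> E x y \<longleftrightarrow> fst (h x) = fst (h y)"
proof -
  define cls where "cls x = Collect (E x)" for x
  have cls_eq: "cls x = cls y \<longleftrightarrow> E x y" for x y
    using E unfolding cls_def equivp_def by (metis Collect_mem_eq Collect_cong mem_Collect_eq)
  have self: "x \<in> cls x" for x
    using equivp_reflp[OF E] by (simp add: cls_def)
  have count: "countable (cls x)" if "x \<in> V" for x
    using sat[OF that] by (auto intro: countable_subset[OF _ V] simp: cls_def)
  have countQ: "countable (cls ` V)" using V by blast
  have infQ: "infinite (cls ` V)" using many by (simp add: cls_def[abs_def])
  define h where "h x = (to_nat_on (cls ` V) (cls x), to_nat_on (cls x) x)" for x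
  have fst: "E x y \<longleftrightarrow> fst (h x) = fst (h y)" if "x \<in> V" "y \<in> V" for x y
    using that countQ by (simp add: h_def flip: cls_eq)
  have "inj_on h V"
  proof (rule inj_onI)
    fix x y assume xy: "x \<in> V" "y \<in> V" "h x = h y"
    then have "cls x = cls y" using fst cls_eq by simp
    then have "x \<in> cls x" "y \<in> cls x" "to_nat_on (cls x) x = to_nat_on (cls x) y"
      using xy self by (auto simp: h_def)
    then show "x = y" using count[OF xy(1)] by simp
  qed
  moreover have "p \<in> h ` V" for p
  proof -
    obtain i j where p: "p = (i, j)" by (cases p)
    obtain x where x: "x \<in> V" "to_nat_on (cls ` V) (cls x) = i"
      using to_nat_on_surj[OF countQ infQ, of i] by blast
    obtain y where y: "y \<in> cls x" "to_nat_on (cls x) y = j"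
      using to_nat_on_surj[OF count[OF x(1)], of j] inf[OF x(1)] by (auto simp: cls_def)
    have "y \<in> V" "cls y = cls x"
      using sat[OF x(1)] y(1) equivp_symp[OF E] cls_eq by (auto simp: cls_def)
    then show ?thesis using x y p by (auto simp: h_def image_iff intro!: bexI[of _ y])
  qed
  ultimately have "bij_betw h V UNIV" by (auto simp: bij_betw_def)
  with fst that show thesis by blast
qed

text \<open>Hilbert's hotel: the countably many classes in \<open>W\<close> are absorbed by countably many others.\<close>

lemma absorb_countably_many_classes:
  assumes E: "equivp E"
    and inf: "\<And>x. infinite (Collect (E x))" and count: "\<And>x. countable (Collect (E x))"
    and W: "countable W" "\<And>x y. x \<in> W \<Longrightarrow> E x y \<Longrightarrow> y \<in> W"
    and unc: "uncountable (- W)"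
  obtains \<sigma> D where "bij_betw \<sigma> UNIV (- W)" "\<And>x y. E (\<sigma> x) (\<sigma> y) \<longleftrightarrow> E x y"
    "countable D" "\<And>x. x \<notin> D \<Longrightarrow> \<sigma> x = x"
proof -
  define cls where "cls x = Collect (E x)" for x
  have self: "x \<in> cls x" for x
    using equivp_reflp[OF E] by (simp add: cls_def)
  have cls_abs: "cls = (\<lambda>x. Collect (E x))"
    by (simp add: cls_def fun_eq_iff)
  have sym: "E x y \<Longrightarrow> E y x" for x y
    using equivp_symp[OF E] .
  have trans: "E x y \<Longrightarrow> E y z \<Longrightarrow> E x z" for x y z
    using equivp_transp[OF E] .
  \<comment> \<open>Finitely many countable classes cannot cover an uncountable set.\<close>
  have "infinite (cls ` (- W))"
  proof
    assume "finite (cls ` (- W))"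
    then have "countable (\<Union> (cls ` (- W)))"
      using count countable_UN[OF countable_finite, of "cls ` (- W)" id] by (force simp: cls_def)
    moreover have "- W \<subseteq> \<Union> (cls ` (- W))" using self by blast
    ultimately show False using unc countable_subset by blast
  qed
  \<comment> \<open>The classes in \<open>Q\<close> are the rooms: their union \<open>V\<close>
    makes space for itself together with \<open>W\<close>.\<close>
  then obtain Q where Q: "Q \<subseteq> cls ` (- W)" "countable Q" "infinite Q"
    using infinite_countable_subset' by blast
  define V where "V = \<Union> Q"
  have satV: "y \<in> V" if "x \<in> V" "E x y" for x y
  proof -
    from that(1) obtain C where C: "C \<in> Q" "x \<in> C" unfolding V_def by blast
    then obtain z where "C = cls z" using Q(1) by blast
    then have "y \<in> C" using C(2) trans[OF _ that(2)] by (simp add: cls_def)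
    then show ?thesis using C(1) unfolding V_def by blast
  qed
  have VW: "V \<subseteq> - W"
  proof
    fix x assume "x \<in> V"
    then obtain z where "z \<notin> W" "x \<in> cls z" using Q(1) unfolding V_def by blast
    then show "x \<in> - W" using W(2)[of x z] sym[of z x] by (auto simp: cls_def)
  qed
  have countV: "countable V"
    unfolding V_def using countable_UN[OF Q(2), of id] Q(1) count by (force simp: cls_def)
  have "Q \<subseteq> cls ` V"
  proof
    fix C assume C: "C \<in> Q"
    with Q(1) obtain x where "C = cls x" by blast
    then show "C \<in> cls ` V" using C self unfolding V_def by blast
  qed
  then have infV: "infinite (cls ` V)" using Q(3) finite_subset by blast
  obtain h1 where h1: "bij_betw h1 V (UNIV :: (nat \<times> nat) set)"
      "\<And>x y. x \<in> V \<Longrightarrow> y \<in> V \<Longrightarrow> E x y \<longleftrightarrow> fst (h1 x) = fst (h1 y)"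
    by (rule countable_classes_enumeration[OF E countV satV inf infV[unfolded cls_abs]]) blast+
  define D where "D = W \<union> V"
  have satD: "y \<in> D" if "x \<in> D" "E x y" for x y
    using that W(2) satV unfolding D_def by blast
  have countD: "countable D" using W countV by (simp add: D_def)
  have infD: "infinite (cls ` D)"
    using infV by (simp add: D_def image_Un)
  obtain h2 where h2: "bij_betw h2 D (UNIV :: (nat \<times> nat) set)"
      "\<And>x y. x \<in> D \<Longrightarrow> y \<in> D \<Longrightarrow> E x y \<longleftrightarrow> fst (h2 x) = fst (h2 y)"
    by (rule countable_classes_enumeration[OF E countD satD inf infD[unfolded cls_abs]]) blast+
  \<comment> \<open>Both \<open>D\<close> and \<open>V\<close> look like pairs of numbers related by
    equal first components, so passing through these coordinates moves \<open>D\<close> onto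
    \<open>V\<close> and preserves classes in both directions.\<close>
  define \<tau> where "\<tau> = inv_into V h1 \<circ> h2"
  have \<tau>: "bij_betw \<tau> D V"
    unfolding \<tau>_def using h2(1) bij_betw_inv_into[OF h1(1)] by (rule bij_betw_trans)
  have h1\<tau>: "h1 (\<tau> x) = h2 x" for x
    using h1(1) by (simp add: \<tau>_def bij_betw_inv_into_right)
  have \<tau>V: "\<tau> x \<in> V" if "x \<in> D" for x
    using \<tau> that by (rule bij_betw_apply)
  define \<sigma> where "\<sigma> x = (if x \<in> D then \<tau> x else x)" for x
  have "bij_betw \<sigma> (D \<union> - D) (V \<union> - D)"
  proof (rule bij_betw_combine)
    show "bij_betw \<sigma> D V" using \<tau> by (simp add: \<sigma>_def cong: bij_betw_cong)
    show "bij_betw \<sigma> (- D) (- D)"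
      by (simp add: \<sigma>_def bij_betw_def inj_on_def image_def)
    show "V \<inter> - D = {}" by (auto simp: D_def)
  qed
  moreover have "V \<union> - D = - W" using VW by (auto simp: D_def)
  ultimately have "bij_betw \<sigma> UNIV (- W)" by simp
  moreover have "E (\<sigma> x) (\<sigma> y) \<longleftrightarrow> E x y" for x y
  proof -
    have mixed: "E x y \<Longrightarrow> x \<in> D \<longleftrightarrow> y \<in> D" for x y
      using satD sym by blast
    have VD: "V \<subseteq> D" by (simp add: D_def)
    show ?thesis
    proof (cases "x \<in> D \<and> y \<in> D")
      case True
      then show ?thesis using h1(2)[of "\<tau> x" "\<tau> y"] h2(2) \<tau>V by (simp add: \<sigma>_def h1\<tau>)
    next
      case False
      have "\<tau> z \<in> D" if "z \<in> D" for z using \<tau>V[OF that] VD by blast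
      with False show ?thesis using mixed[of "\<sigma> x" "\<sigma> y"] mixed[of x y]
        by (auto simp: \<sigma>_def)
    qed
  qed
  moreover have "\<sigma> x = x" if "x \<notin> D" for x using that by (simp add: \<sigma>_def)
  ultimately show thesis using countD that by blast
qed

section \<open>Refining the topology\<close>

lemma exists_closed_witnesses:
  fixes S :: "(nat \<Rightarrow> bool) set"
  assumes "gdelta_in euclidean S"
  shows "\<exists>F :: nat \<Rightarrow> (nat \<Rightarrow> bool) set. - S = (\<Union>n. F n) \<and> (\<forall>n. closed (F n))"
proof -
  have "fsigma_in euclidean (- S)"
    using assms by (simp add: gdelta_in_fsigma_in Compl_eq_Diff_UNIV)
  then obtain C :: "nat \<Rightarrow> (nat \<Rightarrow> bool) set" where "\<forall>n. closed (C n)" "\<Union> (range C) = - S"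
    unfolding fsigma_in_ascending by auto
  then show ?thesis by (intro exI[of _ C]) auto
qed

text \<open>A choice made once for each set, so that the closed sets exhausting its complement can
  be named in turn. It is meaningful for G-delta sets.\<close>

definition witness :: "(nat \<Rightarrow> bool) set \<Rightarrow> nat \<Rightarrow> (nat \<Rightarrow> bool) set" where
  "witness S = (SOME F. - S = (\<Union>n. F n) \<and> (\<forall>n. closed (F n)))"

lemma witness:
  assumes "gdelta_in euclidean S"
  shows Compl_eq_UN_witness: "- S = (\<Union>n. witness S n)"
    and closed_witness: "closed (witness S n)"
  using someI_ex[OF exists_closed_witnesses[OF assms]] unfolding witness_def by blast+

text \<open>An integer coordinate whose continuity amounts to \<open>S\<close> being clopen, with
  the complement split further according to the first closed witness.\<close>

definition witness_rank :: "(nat \<Rightarrow> bool) set \<Rightarrow> (nat \<Rightarrow> bool) \<Rightarrow> nat" where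
  "witness_rank S x = (if x \<in> S then 0 else Suc (LEAST m. x \<in> witness S m))"

lemma witness_rank_eq_0_iff [simp]: "witness_rank S x = 0 \<longleftrightarrow> x \<in> S"
  by (simp add: witness_rank_def)

lemma witness_rank_eq_Suc_iff:
  assumes "gdelta_in euclidean S"
  shows "witness_rank S x = Suc m \<longleftrightarrow> x \<in> witness S m \<and> (\<forall>i<m. x \<notin> witness S i)"
proof
  assume r: "witness_rank S x = Suc m"
  then have "x \<notin> S" and m: "m = (LEAST m. x \<in> witness S m)"
    by (auto simp: witness_rank_def split: if_splits)
  then obtain i where "x \<in> witness S i" using Compl_eq_UN_witness[OF assms] by blast
  then show "x \<in> witness S m \<and> (\<forall>i<m. x \<notin> witness S i)"
    unfolding m by (auto intro: LeastI dest: not_less_Least)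
next
  assume r: "x \<in> witness S m \<and> (\<forall>i<m. x \<notin> witness S i)"
  then have "x \<notin> S" using Compl_eq_UN_witness[OF assms] by blast
  moreover have "(LEAST m. x \<in> witness S m) = m"
    using r by (intro Least_equality) (auto simp: not_less[symmetric])
  ultimately show "witness_rank S x = Suc m" by (simp add: witness_rank_def)
qed

text \<open>The approximation to \<open>witness_rank\<close> that searches the first
  \<open>n\<close> witnesses only; 0 means that nothing has been found so far.\<close>

definition bounded_rank :: "nat \<Rightarrow> (nat \<Rightarrow> bool) set \<Rightarrow> (nat \<Rightarrow> bool) \<Rightarrow> nat" where
  "bounded_rank n S x = (if \<exists>m<n. x \<in> witness S m then Suc (LEAST m. x \<in> witness S m) else 0)"

text \<open>Finitely many closed witnesses are involved, so every level set is open or the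
  intersection of a closed and an open set. The level set of 0 for the full rank is
  \<open>S\<close>, which in general is only G-delta.\<close>

lemma fsigma_in_bounded_rank:
  assumes S: "gdelta_in euclidean S"
  shows "fsigma_in euclidean {x. bounded_rank n S x = j}"
proof -
  have open_avoid: "open {x. \<forall>i<m. x \<notin> witness S i}" for m
  proof -
    have "{x. \<forall>i<m. x \<notin> witness S i} = (\<Inter>i\<in>{..<m}. - witness S i)" by auto
    then show ?thesis using closed_witness[OF S] by (simp add: open_INT open_Compl)
  qed
  show ?thesis
  proof (cases j)
    case 0
    then have "{x. bounded_rank n S x = j} = {x. \<forall>i<n. x \<notin> witness S i}"
      by (auto simp: bounded_rank_def)
    then show ?thesis using open_avoid[of n] by (simp add: fsigma_in_open_fun)
  next
    case (Suc m)
    have least: "(LEAST m. x \<in> witness S m) = m \<longleftrightarrow> x \<in> witness S m \<and> (\<forall>i<m. x \<notin> witness S i)"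
      if "\<exists>m. x \<in> witness S m" for x
    proof
      assume "(LEAST m. x \<in> witness S m) = m"
      then show "x \<in> witness S m \<and> (\<forall>i<m. x \<notin> witness S i)"
        using LeastI_ex[OF that] not_less_Least by blast
    next
      assume "x \<in> witness S m \<and> (\<forall>i<m. x \<notin> witness S i)"
      then show "(LEAST m. x \<in> witness S m) = m"
        by (intro Least_equality) (auto simp: not_less[symmetric])
    qed
    have "bounded_rank n S x = j \<longleftrightarrow> m < n \<and> x \<in> witness S m \<and> (\<forall>i<m. x \<notin> witness S i)" for x
    proof (cases "\<exists>m<n. x \<in> witness S m")
      case True
      then obtain i where i: "i < n" "x \<in> witness S i" by blast
      then have "bounded_rank n S x = j \<longleftrightarrow> (LEAST m. x \<in> witness S m) = m"
        using Suc True by (simp add: bounded_rank_def)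
      then show ?thesis using least[of x] i by (meson not_less order.strict_trans1)
    next
      case False
      then show ?thesis using Suc by (auto simp: bounded_rank_def)
    qed
    then have "{x. bounded_rank n S x = j} =
        (if m < n then witness S m \<inter> {x. \<forall>i<m. x \<notin> witness S i} else {})"
      by auto
    also have "fsigma_in euclidean \<dots>"
      using closed_witness[OF S] open_avoid
      by (simp add: fsigma_in_Int closed_imp_fsigma_in fsigma_in_open_fun)
    finally show ?thesis .
  qed
qed

lemma eventually_bounded_rank:
  assumes S: "gdelta_in euclidean S"
  shows "eventually (\<lambda>n. witness_rank S x = bounded_rank n S x) sequentially"
proof (cases "x \<in> S")
  case True
  then have "x \<notin> witness S m" for m using Compl_eq_UN_witness[OF S] by blast
  then show ?thesis using True by (simp add: witness_rank_def bounded_rank_def)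
next
  case False
  then obtain m where m: "x \<in> witness S m" using Compl_eq_UN_witness[OF S] by blast
  show ?thesis
    unfolding eventually_sequentially
  proof (intro exI[of _ "Suc m"] allI impI)
    fix n assume "Suc m \<le> n"
    then have "\<exists>m<n. x \<in> witness S m" using m by (auto simp: Suc_le_eq)
    then show "witness_rank S x = bounded_rank n S x"
      using False by (simp add: witness_rank_def bounded_rank_def)
  qed
qed

text \<open>Names for the members of the smallest family with the required closure properties.
  Countability of the family comes from the datatype, and \<open>Preimage s t Whole\<close> names
  the domain of a partial map.\<close>

datatype 's code = Whole | Bit nat | Witness "'s code" nat | Preimage 's 's "'s code"

instance code :: (countable) countable
  by countable_datatype

text \<open>An equivalence relation given as a countable union of graphs of partial homeomorphisms;
  exchanging the two indices inverts the map.\<close>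

locale partial_homeomorphisms =
  fixes A :: "'s::countable \<Rightarrow> 's \<Rightarrow> (nat \<Rightarrow> bool) set"
    and f :: "'s \<Rightarrow> 's \<Rightarrow> (nat \<Rightarrow> bool) \<Rightarrow> (nat \<Rightarrow> bool)"
    and E :: "(nat \<Rightarrow> bool) \<Rightarrow> (nat \<Rightarrow> bool) \<Rightarrow> bool"
  assumes gdelta: "gdelta_in euclidean (A s t)"
    and continuous: "continuous_on (A s t) (f s t)"
    and f_in: "x \<in> A s t \<Longrightarrow> f s t x \<in> A t s"
    and f_f: "x \<in> A s t \<Longrightarrow> f t s (f s t x) = x"
    and E_iff: "E x y \<longleftrightarrow> (\<exists>s t. x \<in> A s t \<and> y = f s t x)"
    and equivp: "equivp E"
    and infinite_class: "infinite (Collect (E x))"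
begin

primrec code_set :: "'s code \<Rightarrow> (nat \<Rightarrow> bool) set" where
  "code_set Whole = UNIV"
| "code_set (Bit n) = {x. x n}"
| "code_set (Witness c m) = witness (code_set c) m"
| "code_set (Preimage s t c) = {x \<in> A s t. f s t x \<in> code_set c}"

lemma gdelta_code_set: "gdelta_in euclidean (code_set c)"
proof (induction c)
  case Whole
  show ?case by (simp add: open_imp_gdelta_in)
next
  case (Bit n)
  show ?case using clopen_bit by (simp add: open_imp_gdelta_in)
next
  case (Witness c m)
  then show ?case by (simp add: closed_witness closed_imp_gdelta_in_nat_bool)
next
  case (Preimage s t c)
  then show ?case by (simp add: gdelta_in_continuous_preimage gdelta continuous)
qed

text \<open>The finer topology is the one pulled back along this map: its basic neighbourhoods of
  \<open>x\<close> are the sets of \<open>y\<close> with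
  \<open>agree k (refine x) (refine y)\<close>.\<close>

definition refine :: "(nat \<Rightarrow> bool) \<Rightarrow> nat \<Rightarrow> nat" where
  "refine x n = witness_rank (code_set (from_nat n)) x"

lemma refine_to_nat [simp]: "refine x (to_nat c) = witness_rank (code_set c) x"
  by (simp add: refine_def)

text \<open>This says that the set of points satisfying \<open>P\<close> is clopen in the refined
  topology.\<close>

definition locally_determined :: "((nat \<Rightarrow> bool) \<Rightarrow> bool) \<Rightarrow> bool" where
  "locally_determined P \<longleftrightarrow> (\<forall>x. \<exists>k. \<forall>y. agree k (refine x) (refine y) \<longrightarrow> P y = P x)"

lemma locally_determined_code: "locally_determined (\<lambda>x. x \<in> code_set c)"
  unfolding locally_determined_def
proof
  fix x
  have "(y \<in> code_set c) = (x \<in> code_set c)" if "agree (Suc (to_nat c)) (refine x) (refine y)" for y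
  proof -
    have "refine x (to_nat c) = refine y (to_nat c)" using that unfolding agree_def by blast
    then show ?thesis using witness_rank_eq_0_iff by (metis refine_to_nat)
  qed
  then show "\<exists>k. \<forall>y. agree k (refine x) (refine y) \<longrightarrow> (y \<in> code_set c) = (x \<in> code_set c)" by blast
qed

lemma locally_determined_not: "locally_determined P \<Longrightarrow> locally_determined (\<lambda>x. \<not> P x)"
  by (simp add: locally_determined_def)

lemma locally_determined_conj:
  assumes "locally_determined P" "locally_determined Q"
  shows "locally_determined (\<lambda>x. P x \<and> Q x)"
  unfolding locally_determined_def
proof
  fix x
  obtain k where k: "\<forall>y. agree k (refine x) (refine y) \<longrightarrow> P y = P x"
    using assms(1) unfolding locally_determined_def by blast
  obtain l where l: "\<forall>y. agree l (refine x) (refine y) \<longrightarrow> Q y = Q x"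
    using assms(2) unfolding locally_determined_def by blast
  have "(P y \<and> Q y) = (P x \<and> Q x)" if "agree (max k l) (refine x) (refine y)" for y
  proof -
    have "agree k (refine x) (refine y)" "agree l (refine x) (refine y)"
      using agree_mono[OF that] by simp_all
    then show ?thesis using k[rule_format, of y] l[rule_format, of y] by simp
  qed
  then show "\<exists>k. \<forall>y. agree k (refine x) (refine y) \<longrightarrow> (P y \<and> Q y) = (P x \<and> Q x)" by blast
qed

lemma locally_determined_disj:
  assumes "locally_determined P" "locally_determined Q"
  shows "locally_determined (\<lambda>x. P x \<or> Q x)"
  using locally_determined_not[OF locally_determined_conj[OF assms[THEN locally_determined_not]]]
  by simp

lemma locally_determined_bit: "locally_determined (\<lambda>x. x n = b)"
  using locally_determined_code[of "Bit n"] locally_determined_not[OF locally_determined_code[of "Bit n"]]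
  by (cases b) simp_all

lemma refine_determines_bits: "\<exists>k. \<forall>y. agree k (refine x) (refine y) \<longrightarrow> agree n x y"
  unfolding agree_def[of n]
proof (rule agree_combine)
  fix i
  show "\<exists>k. \<forall>y. agree k (refine x) (refine y) \<longrightarrow> x i = y i"
    using locally_determined_bit[of i "x i"] unfolding locally_determined_def by metis
qed

lemma inj_refine: "inj refine"
proof (rule injI)
  fix x y assume "refine x = refine y"
  then have "agree n x y" for n using refine_determines_bits[of x n] by auto
  then show "x = y" by (auto simp: agree_def fun_eq_iff)
qed

text \<open>Each rank of \<open>g x\<close> is decided by finitely many memberships: rank 0 by the
  set itself, rank \<open>Suc m\<close> by the witnesses up to \<open>m\<close>, which have codes of
  their own.\<close>

lemma refine_continuous:
  assumes g: "\<And>c. locally_determined (\<lambda>x. g x \<in> code_set c)"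
  shows "\<exists>k. \<forall>y. agree k (refine x) (refine y) \<longrightarrow> agree n (refine (g x)) (refine (g y))"
  unfolding agree_def[of n]
proof (rule agree_combine)
  fix i
  define c :: "'s code" where "c = from_nat i"
  have ri: "refine z i = witness_rank (code_set c) z" for z by (simp add: refine_def c_def)
  show "\<exists>k. \<forall>y. agree k (refine x) (refine y) \<longrightarrow> refine (g x) i = refine (g y) i"
  proof (cases "witness_rank (code_set c) (g x)")
    case 0
    obtain k where "\<forall>y. agree k (refine x) (refine y) \<longrightarrow> (g y \<in> code_set c) = (g x \<in> code_set c)"
      using g[of c] unfolding locally_determined_def by blast
    then show ?thesis using 0 unfolding ri by (metis witness_rank_eq_0_iff)
  next
    case (Suc m)
    have "\<exists>k. \<forall>y. agree k (refine x) (refine y) \<longrightarrow>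
        (\<forall>j<Suc m. (g y \<in> witness (code_set c) j) = (g x \<in> witness (code_set c) j))"
    proof (rule agree_combine)
      fix j
      show "\<exists>k. \<forall>y. agree k (refine x) (refine y) \<longrightarrow>
          (g y \<in> witness (code_set c) j) = (g x \<in> witness (code_set c) j)"
        using g[of "Witness c j"] unfolding locally_determined_def by simp
    qed
    then obtain k where k: "\<forall>y. agree k (refine x) (refine y) \<longrightarrow>
        (\<forall>j<Suc m. (g y \<in> witness (code_set c) j) = (g x \<in> witness (code_set c) j))" by blast
    have "witness_rank (code_set c) (g y) = Suc m" if "agree k (refine x) (refine y)" for y
      using k[rule_format, OF that] Suc unfolding witness_rank_eq_Suc_iff[OF gdelta_code_set]
      by (meson lessI less_SucI)
    then show ?thesis using Suc unfolding ri by metis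
  qed
qed

text \<open>
  This is completeness of the refined topology. A limit of points outside a set of the family stays
  in one of its closed witnesses, hence outside; since the witnesses belong to the family as well,
  a limit of points inside the set lies outside every witness, hence inside.
\<close>

lemma refine_limit:
  assumes y: "\<And>k. agree k z (refine (y k))"
  obtains x where "refine x = z" "y \<longlonglongrightarrow> x"
proof -
  have ev: "eventually (\<lambda>k. witness_rank (code_set c) (y k) = z (to_nat c)) sequentially" for c
    unfolding eventually_sequentially
  proof (intro exI[of _ "Suc (to_nat c)"] allI impI)
    fix k assume "Suc (to_nat c) \<le> k"
    then have "z (to_nat c) = refine (y k) (to_nat c)" using y[of k] by (simp add: agree_def)
    then show "witness_rank (code_set c) (y k) = z (to_nat c)" by simp
  qed
  have ev_in: "eventually (\<lambda>k. y k \<in> code_set c) sequentially" if "z (to_nat c) = 0" for c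
    using ev[of c] that by simp
  have ev_notin: "eventually (\<lambda>k. y k \<notin> code_set c) sequentially" if "z (to_nat c) \<noteq> 0" for c
    using ev[of c] by (rule eventually_mono) (use that witness_rank_eq_0_iff in metis)
  have ev_wit: "eventually (\<lambda>k. y k \<in> witness (code_set c) m) sequentially"
    if "z (to_nat c) = Suc m" for c m
    using ev[of c] by (rule eventually_mono) (use that witness_rank_eq_Suc_iff[OF gdelta_code_set] in metis)
  \<comment> \<open>The limit can be read off from \<open>z\<close>, because the bits are themselves
    named by codes and rank 0 means membership.\<close>
  define x where "x n \<longleftrightarrow> z (to_nat (Bit n :: 's code)) = 0" for n
  have lim: "y \<longlonglongrightarrow> x"
    unfolding tendsto_fun_iff_agree
  proof (intro allI eventually_agreeI)
    fix i
    show "eventually (\<lambda>k. x i = y k i) sequentially"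
      using ev_in[of "Bit i"] ev_notin[of "Bit i"]
      by (cases "x i") (auto simp: x_def elim: eventually_mono)
  qed
  have wit_in: "x \<in> witness (code_set c) m" if "z (to_nat c) = Suc m" for c m
    using Lim_in_closed_set[OF closed_witness[OF gdelta_code_set] ev_wit[OF that] _ lim] by simp
  have not_in: "x \<notin> code_set c" if "z (to_nat c) \<noteq> 0" for c
    using wit_in[of c] that Compl_eq_UN_witness[OF gdelta_code_set[of c]]
    by (metis Compl_iff UN_I UNIV_I not0_implies_Suc)
  have in_iff: "x \<in> code_set c \<longleftrightarrow> z (to_nat c) = 0" for c
  proof
    assume c: "z (to_nat c) = 0"
    show "x \<in> code_set c"
    proof (rule ccontr)
      assume "x \<notin> code_set c"
      then obtain m where m: "x \<in> code_set (Witness c m)"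
        using Compl_eq_UN_witness[OF gdelta_code_set[of c]] by auto
      then have "z (to_nat (Witness c m)) = 0" using not_in by blast
      from eventually_conj[OF ev_in[OF this] ev_in[OF c]]
      obtain k where "y k \<in> witness (code_set c) m" "y k \<in> code_set c"
        by (auto simp: eventually_sequentially)
      then show False using Compl_eq_UN_witness[OF gdelta_code_set[of c]] by blast
    qed
  qed (use not_in in blast)
  have "refine x n = z n" for n
  proof -
    define c :: "'s code" where "c = from_nat n"
    have "eventually (\<lambda>k. refine (y k) n = z n) sequentially"
      unfolding eventually_sequentially
    proof (intro exI[of _ "Suc n"] allI impI)
      fix k assume "Suc n \<le> k"
      then show "refine (y k) n = z n" using y[of k] by (simp add: agree_def)
    qed
    \<comment> \<open>\<open>from_nat\<close> need not be injective, so \<open>n\<close> may differ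
      from \<open>to_nat c\<close>; both values of \<open>z\<close> are nevertheless eventual values
      of the same rank.\<close>
    from eventually_conj[OF this ev[of c]] have zc: "z n = z (to_nat c)"
      by (auto simp: eventually_sequentially refine_def c_def)
    show ?thesis
    proof (cases "z (to_nat c)")
      case 0
      then have "x \<in> code_set c" using in_iff by blast
      then show ?thesis using 0 by (simp add: zc refine_def flip: c_def)
    next
      case (Suc m)
      have "x \<notin> witness (code_set c) i" if "i < m" for i
      proof -
        have "eventually (\<lambda>k. y k \<notin> witness (code_set c) i) sequentially"
          using ev[of c]
          by (rule eventually_mono) (use that Suc witness_rank_eq_Suc_iff[OF gdelta_code_set] in auto)
        then have "z (to_nat (Witness c i)) \<noteq> 0"
          using eventually_conj[OF ev_in[of "Witness c i"]] by (force simp: eventually_sequentially)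
        then show ?thesis using in_iff[of "Witness c i"] by simp
      qed
      then have "witness_rank (code_set c) x = Suc m"
        using wit_in[OF Suc] by (simp add: witness_rank_eq_Suc_iff[OF gdelta_code_set])
      then show ?thesis using Suc by (simp add: zc refine_def flip: c_def)
    qed
  qed
  then have "refine x = z" by blast
  with lim that show thesis by blast
qed

section \<open>The countable invariant set that is removed\<close>

lemma countable_class: "countable (Collect (E x))"
proof -
  have "Collect (E x) \<subseteq> range (\<lambda>(s, t). f s t x)"
    unfolding E_iff by auto
  then show ?thesis by (rule countable_subset) simp
qed

definition basic :: "nat list \<Rightarrow> (nat \<Rightarrow> bool) set" where
  "basic l = {y. map (refine y) [0..<length l] = l}"

lemma basic_refine: "basic (map (refine x) [0..<k]) = {y. agree k (refine x) (refine y)}"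
  unfolding basic_def agree_iff_map by auto

text \<open>The points with a countable neighbourhood in the refined topology. There are countably
  many basic sets, so their union is countable as well.\<close>

definition negligible_points :: "(nat \<Rightarrow> bool) set" where
  "negligible_points = \<Union> (basic ` {l. countable (basic l)})"

lemma countable_negligible_points: "countable negligible_points"
  unfolding negligible_points_def by (rule countable_UN) simp_all

lemma uncountable_nbhd: "x \<notin> negligible_points \<Longrightarrow> uncountable {y. agree k (refine x) (refine y)}"
proof
  assume x: "x \<notin> negligible_points"
  assume "countable {y. agree k (refine x) (refine y)}"
  then have "countable (basic (map (refine x) [0..<k]))" by (simp add: basic_refine)
  moreover have "x \<in> basic (map (refine x) [0..<k])" by (simp add: basic_refine)
  ultimately show False using x unfolding negligible_points_def by blast
qed

text \<open>One point in each basic set that meets the perfect part, hence a dense subset of that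
  part; for other \<open>l\<close> the value is arbitrary.\<close>

definition sample :: "nat list \<Rightarrow> (nat \<Rightarrow> bool)" where
  "sample l = (SOME x. x \<in> basic l \<and> x \<notin> negligible_points)"

text \<open>
  Removing a countable dense invariant set from the perfect part makes every neighbourhood in the
  remaining space non-compact.
\<close>

definition removed :: "(nat \<Rightarrow> bool) set" where
  "removed = {y. \<exists>x \<in> negligible_points \<union> range sample. E x y}"

lemma countable_removed: "countable removed"
proof -
  have "removed = (\<Union>x \<in> negligible_points \<union> range sample. Collect (E x))"
    by (auto simp: removed_def)
  moreover have "countable (negligible_points \<union> range sample)"
    using countable_negligible_points by simp
  ultimately show ?thesis using countable_class by (simp only: countable_UN)
qed

lemma removed_invariant: "E x y \<Longrightarrow> x \<in> removed \<longleftrightarrow> y \<in> removed"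
proof -
  have imp: "E x y \<Longrightarrow> x \<in> removed \<Longrightarrow> y \<in> removed" for x y
    unfolding removed_def using equivp_transp[OF equivp, of _ x y] by blast
  assume "E x y"
  then show ?thesis using imp[of x y] imp[of y x] equivp_symp[OF equivp, of x y] by blast
qed

lemma subset_removed: "negligible_points \<subseteq> removed" "sample l \<in> removed"
  using equivp_reflp[OF equivp] by (auto simp: removed_def)

lemma uncountable_retained: "uncountable (- removed)"
proof
  assume "countable (- removed)"
  then have "countable (removed \<union> - removed)" using countable_removed by blast
  then show False using uncountable_UNIV_nat_bool by simp
qed

section \<open>The retained points as a closed subset of Baire space\<close>

definition hole :: "nat \<Rightarrow> nat \<Rightarrow> bool" where
  "hole = from_nat_into removed"

lemma range_hole: "range hole = removed"
  unfolding hole_def using countable_removed subset_removed(2)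
  by (intro range_from_nat_into) auto

text \<open>Even coordinates carry the refined topology; odd ones measure closeness to the removed
  points. Convergence to a hole makes an odd coordinate unbounded, so deleting the holes leaves a
  closed image.\<close>

definition embed :: "(nat \<Rightarrow> bool) \<Rightarrow> nat \<Rightarrow> nat" where
  "embed x i = (if even i then refine x (i div 2) else first_difference (hole (i div 2)) x)"

lemma embed_even [simp]: "embed x (2 * i) = refine x i"
  and embed_odd [simp]: "embed x (Suc (2 * i)) = first_difference (hole i) x"
  by (simp_all add: embed_def)

lemma agree_refine_if_agree_embed: "agree (2 * k) (embed x) (embed y) \<Longrightarrow> agree k (refine x) (refine y)"
  unfolding agree_def by (metis embed_even mult_less_cancel1 zero_less_numeral)

text \<open>A point that is no hole differs from a given hole at some bit, and finitely many values
  of \<open>refine\<close> decide the bits up to there. So the odd coordinates do not change the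
  topology on the retained points.\<close>

lemma refine_determines_embed:
  assumes "x \<notin> removed"
  shows "\<exists>k. \<forall>y. agree k (refine x) (refine y) \<longrightarrow> agree n (embed x) (embed y)"
  unfolding agree_def[of n]
proof (rule agree_combine)
  fix i
  show "\<exists>k. \<forall>y. agree k (refine x) (refine y) \<longrightarrow> embed x i = embed y i"
  proof (cases "even i")
    case True
    then show ?thesis
      by (intro exI[of _ "Suc (i div 2)"]) (simp add: embed_def agree_def)
  next
    case False
    let ?w = "hole (i div 2)"
    have "x \<noteq> ?w" using assms range_hole by blast
    moreover obtain k where "\<forall>y. agree k (refine x) (refine y) \<longrightarrow> agree (Suc (first_difference ?w x)) x y"
      using refine_determines_bits by blast
    ultimately have *: "first_difference ?w y = first_difference ?w x"
      if "agree k (refine x) (refine y)" for y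
      using that by (blast intro: first_difference_cong)
    have "embed x i = embed y i" if "agree k (refine x) (refine y)" for y
      unfolding embed_def if_not_P[OF False] *[OF that] ..
    then show ?thesis by blast
  qed
qed

lemma inj_embed: "inj embed"
proof (rule injI)
  fix x y assume "embed x = embed y"
  then have "refine x i = refine y i" for i using embed_even[of x i] embed_even[of y i] by simp
  then show "x = y" by (intro injD[OF inj_refine]) (simp add: fun_eq_iff)
qed

text \<open>Completeness of the refined topology yields a limit \<open>x\<close>. An odd coordinate
  of \<open>z\<close> fixes the place where points near \<open>x\<close> differ from a hole, and
  \<open>x\<close> inherits this difference.\<close>

lemma closed_embed: "closed (embed ` (- removed))"
  unfolding closed_iff_agree
proof (intro allI impI)
  fix z assume z: "\<forall>n. \<exists>u\<in>embed ` (- removed). agree n z u"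
  have "\<exists>y. y \<notin> removed \<and> agree (2 * k) z (embed y)" for k
    using z[rule_format, of "2 * k"] by blast
  then obtain y where y: "\<And>k. y k \<notin> removed" "\<And>k. agree (2 * k) z (embed (y k))"
    by metis
  have "agree k (\<lambda>i. z (2 * i)) (refine (y k))" for k
    using y(2)[of k] unfolding agree_def by (metis embed_even mult_less_cancel1 zero_less_numeral)
  then obtain x where x: "refine x = (\<lambda>i. z (2 * i))" "y \<longlonglongrightarrow> x"
    by (rule refine_limit)
  have hole: "x \<noteq> hole j \<and> first_difference (hole j) x = z (Suc (2 * j))" for j
  proof -
    let ?n = "z (Suc (2 * j))"
    have "eventually (\<lambda>k. agree (Suc ?n) x (y k)) sequentially"
      using x(2) unfolding tendsto_fun_iff_agree by blast
    then obtain K where K: "\<And>k. K \<le> k \<Longrightarrow> agree (Suc ?n) x (y k)"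
      unfolding eventually_sequentially by blast
    \<comment> \<open>Past \<open>K\<close> the bits agree with the limit, and past \<open>j\<close>
      the odd coordinate for hole \<open>j\<close> lies within the first
      \<open>2 * k\<close>.\<close>
    define k where "k = max K (Suc j)"
    have xy: "agree (Suc ?n) x (y k)" using K by (simp add: k_def)
    have "Suc (2 * j) < 2 * k" by (auto simp: k_def max_def)
    then have d: "first_difference (hole j) (y k) = ?n"
      using y(2)[of k] unfolding agree_def by (metis embed_odd)
    have neq: "y k \<noteq> hole j" using y(1) range_hole by blast
    have "first_difference (hole j) x = ?n"
      using first_difference_cong[OF neq, of x] agree_sym[OF xy] d by simp
    moreover have "x ?n \<noteq> hole j ?n"
      using first_difference_neq[OF neq] d xy by (simp add: agree_def)
    ultimately show ?thesis by auto
  qed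
  then have "x \<notin> removed" using range_hole by blast
  moreover have "embed x i = z i" for i
  proof (cases "even i")
    case True
    then show ?thesis using x(1) by (auto elim!: evenE)
  next
    case False
    then show ?thesis using hole by (auto elim!: oddE)
  qed
  then have "embed x = z" by blast
  ultimately show "z \<in> embed ` (- removed)" by blast
qed

text \<open>Every neighbourhood of a retained point contains a sample point. This is a hole and is
  approached by retained points, whose coordinate for that hole is therefore unbounded.\<close>

lemma embed_infinitely_branching:
  assumes "u \<in> embed ` (- removed)"
  shows "\<exists>i. infinite {v i |v. v \<in> embed ` (- removed) \<and> agree k u v}"
proof -
  obtain x where x: "u = embed x" "x \<notin> removed" using assms by blast
  obtain m where m: "\<forall>y. agree m (refine x) (refine y) \<longrightarrow> agree k (embed x) (embed y)"
    using refine_determines_embed[OF x(2)] by blast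
  define l where "l = map (refine x) [0..<m]"
  have "x \<in> basic l" unfolding l_def basic_refine by simp
  moreover have "x \<notin> negligible_points" using x(2) subset_removed(1) by blast
  ultimately have q: "sample l \<in> basic l" "sample l \<notin> negligible_points"
    unfolding sample_def by (metis (mono_tags, lifting) someI_ex)+
  have qx: "agree m (refine x) (refine (sample l))"
    using q(1) unfolding l_def basic_refine by simp
  obtain j where j: "hole j = sample l" using subset_removed(2) range_hole by (metis rangeE)
  have "\<exists>y. y \<notin> removed \<and> agree k u (embed y) \<and> n \<le> first_difference (hole j) y" for n
  proof -
    obtain p where p: "\<forall>y. agree p (refine (sample l)) (refine y) \<longrightarrow> agree n (sample l) y"
      using refine_determines_bits by blast
    \<comment> \<open>Neighbourhoods of the sample point are uncountable, whereas only countably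
      many points were removed.\<close>
    have "\<not> {y. agree (max m p) (refine (sample l)) (refine y)} \<subseteq> removed"
      using uncountable_nbhd[OF q(2)] countable_removed countable_subset by blast
    then obtain y where y: "agree (max m p) (refine (sample l)) (refine y)" "y \<notin> removed" by blast
    have "agree m (refine x) (refine y)"
      using agree_trans[OF qx agree_mono[OF y(1)]] by simp
    then have 1: "agree k u (embed y)" using m x(1) by blast
    have "agree n (hole j) y" using p agree_mono[OF y(1), of p] j by simp
    moreover have "y \<noteq> hole j" using y(2) range_hole by blast
    ultimately have "n \<le> first_difference (hole j) y" by (intro first_difference_ge)
    with 1 y(2) show ?thesis by blast
  qed
  then have "\<exists>a\<ge>n. a \<in> {v (Suc (2 * j)) |v. v \<in> embed ` (- removed) \<and> agree k u v}" for n
    by (metis (mono_tags, lifting) ComplI embed_odd imageI mem_Collect_eq)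
  then have "infinite {v (Suc (2 * j)) |v. v \<in> embed ` (- removed) \<and> agree k u v}"
    unfolding infinite_nat_iff_unbounded_le by blast
  then show ?thesis by blast
qed

lemma ex_baire_coordinates:
  "\<exists>\<Psi> :: (nat \<Rightarrow> nat) \<Rightarrow> (nat \<Rightarrow> nat). continuous_on UNIV \<Psi> \<and>
    bij_betw \<Psi> (embed ` (- removed)) UNIV \<and>
    (\<forall>u \<in> embed ` (- removed). \<forall>v \<in> embed ` (- removed). \<forall>n. agree n (\<Psi> u) (\<Psi> v) \<longrightarrow> agree n u v)"
proof -
  have "embed ` (- removed) \<noteq> {}" using uncountable_retained by force
  with closed_embed show ?thesis
    by (rule closed_infinitely_branching_imp_baire_space) (erule embed_infinitely_branching, blast)
qed

section \<open>Involutions generating the relation\<close>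

definition swap :: "'s \<Rightarrow> 's \<Rightarrow> nat \<Rightarrow> bool \<Rightarrow> (nat \<Rightarrow> bool) \<Rightarrow> (nat \<Rightarrow> bool)" where
  "swap s t n b x =
     (if x \<in> A s t \<and> x n = b \<and> f s t x n = (\<not> b) then f s t x
      else if x \<in> A t s \<and> x n = (\<not> b) \<and> f t s x n = b then f t s x else x)"

text \<open>The map \<open>f s t\<close> carries the first case onto the second and
  \<open>f t s\<close> carries it back; bit \<open>n\<close> has opposite values in the two cases,
  so they cannot overlap.\<close>

lemma swap_swap: "swap s t n b (swap s t n b x) = x"
  unfolding swap_def using f_in f_f by auto

lemma E_swap: "E x (swap s t n b x)"
  unfolding swap_def using equivp_reflp[OF equivp, of x] E_iff[of x] by auto

text \<open>Any position where the points differ, together with the bit of \<open>x\<close> there,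
  puts \<open>x\<close> into the first case of a swap.\<close>

lemma ex_swap:
  assumes "E x y" "x \<noteq> y"
  shows "\<exists>s t n b. y = swap s t n b x"
proof -
  obtain s t where st: "x \<in> A s t" "y = f s t x" using assms(1) E_iff by blast
  obtain n where "x n \<noteq> y n" using assms(2) by blast
  then have "y = swap s t n (x n) x" using st by (auto simp: swap_def)
  then show ?thesis by blast
qed

text \<open>Domains, bits of images and preimages of code sets all have codes, so a case distinction
  between them remains clopen.\<close>

lemma locally_determined_swap: "locally_determined (\<lambda>x. swap s t n b x \<in> code_set c)"
proof -
  \<comment> \<open>\<open>P s t b\<close> is the condition of the first case of the swap, and
    \<open>P t s (\<not> b)\<close> is that of the second.\<close>
  define P where "P s t b x \<longleftrightarrow> x \<in> code_set (Preimage s t Whole) \<and> x n = b \<and>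
    (x \<in> code_set (Preimage s t (Bit n))) = (\<not> b)" for s t b and x :: "nat \<Rightarrow> bool"
  have eq: "locally_determined (\<lambda>x. (x \<in> code_set d) = e)" for d e
    using locally_determined_code[of d] locally_determined_not[OF locally_determined_code[of d]]
    by (cases e) simp_all
  have P: "locally_determined (P s t b)" for s t b
    unfolding P_def
    by (intro locally_determined_conj locally_determined_bit locally_determined_code eq)
  have "locally_determined (\<lambda>x. (P s t b x \<and> x \<in> code_set (Preimage s t c)) \<or>
      ((\<not> P s t b x \<and> (P t s (\<not> b) x \<and> x \<in> code_set (Preimage t s c))) \<or>
      (\<not> P s t b x \<and> (\<not> P t s (\<not> b) x \<and> x \<in> code_set c))))"
    by (intro locally_determined_disj locally_determined_conj locally_determined_not
        locally_determined_code P)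
  moreover have "(\<lambda>x. (P s t b x \<and> x \<in> code_set (Preimage s t c)) \<or>
      ((\<not> P s t b x \<and> (P t s (\<not> b) x \<and> x \<in> code_set (Preimage t s c))) \<or>
      (\<not> P s t b x \<and> (\<not> P t s (\<not> b) x \<and> x \<in> code_set c)))) = (\<lambda>x. swap s t n b x \<in> code_set c)"
    by (rule ext) (auto simp: P_def swap_def)
  ultimately show ?thesis by simp
qed

section \<open>Baire class of the embedding\<close>

definition embed_approx :: "nat \<Rightarrow> (nat \<Rightarrow> bool) \<Rightarrow> nat \<Rightarrow> nat" where
  "embed_approx n x i = (if even i then bounded_rank n (code_set (from_nat (i div 2))) x
     else first_difference (hole (i div 2)) x)"

text \<open>The odd coordinates already have F-sigma level sets, so only the ranks are replaced by
  their bounded versions.\<close>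

lemma baire_class_1_embed_approx: "baire_class_1 (embed_approx n)"
proof (rule baire_class_1I)
  fix i j
  show "fsigma_in euclidean {x. embed_approx n x i = j}"
    by (cases "even i")
      (simp_all add: embed_approx_def fsigma_in_bounded_rank gdelta_code_set fsigma_in_first_difference)
qed

lemma embed_approx_tendsto: "(\<lambda>n. embed_approx n x) \<longlonglongrightarrow> embed x"
  unfolding tendsto_fun_iff_agree
proof (intro allI eventually_agreeI)
  fix i
  show "eventually (\<lambda>n. embed x i = embed_approx n x i) sequentially"
    using eventually_bounded_rank[OF gdelta_code_set[of "from_nat (i div 2)"], of x]
    by (cases "even i") (simp_all add: embed_def embed_approx_def refine_def)
qed

text \<open>The \<open>n\<close>-th approximation is corrected at the first \<open>n\<close> points
  of \<open>D\<close>. A finite set is closed and its complement F-sigma, so class 1 survives, and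
  each point of \<open>D\<close> is eventually corrected.\<close>

lemma baire_class_2_modification:
  assumes \<Psi>: "continuous_on UNIV \<Psi>" and D: "countable D"
    and \<Phi>: "\<And>x. x \<notin> D \<Longrightarrow> \<Phi> x = \<Psi> (embed x)"
  shows "baire_class_2 (\<Phi> :: (nat \<Rightarrow> bool) \<Rightarrow> (nat \<Rightarrow> nat))"
proof -
  define Dn where "Dn n = {x \<in> D. to_nat_on D x < n}" for n
  have "inj_on (to_nat_on D) (Dn n)" "to_nat_on D ` Dn n \<subseteq> {..<n}" for n
    using inj_on_subset[OF inj_on_to_nat_on[OF D]] by (auto simp: Dn_def)
  then have fin: "finite (Dn n)" for n
    by (meson finite_imageD finite_lessThan finite_subset)
  define g where "g n x = (if x \<in> Dn n then \<Phi> x else \<Psi> (embed_approx n x))" for n x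
  have "baire_class_1 (g n)" for n
    unfolding baire_class_1_def
  proof (intro allI impI)
    fix U :: "(nat \<Rightarrow> nat) set" assume U: "open U"
    have "open (\<Psi> -` U)" using continuous_on_open_vimage[of UNIV \<Psi>] \<Psi> U by simp
    then have 1: "fsigma_in euclidean (embed_approx n -` (\<Psi> -` U))"
      using baire_class_1_embed_approx unfolding baire_class_1_def by blast
    have 2: "fsigma_in euclidean (- Dn n)"
      by (rule fsigma_in_open_fun) (use closed_finite_fun[OF fin] in \<open>simp add: open_Compl\<close>)
    have "finite (Dn n \<inter> \<Phi> -` U)" using fin by blast
    then have 3: "fsigma_in euclidean (Dn n \<inter> \<Phi> -` U)"
      using closed_finite_fun by (auto intro!: closed_imp_fsigma_in)
    have "g n -` U = (Dn n \<inter> \<Phi> -` U) \<union> (- Dn n \<inter> embed_approx n -` (\<Psi> -` U))"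
      by (auto simp: g_def split: if_splits)
    then show "fsigma_in euclidean (g n -` U)"
      using 1 2 3 by (simp add: fsigma_in_Un fsigma_in_Int)
  qed
  moreover have "(\<lambda>n. g n x) \<longlonglongrightarrow> \<Phi> x" for x
  proof (cases "x \<in> D")
    case True
    have "eventually (\<lambda>n. g n x = \<Phi> x) sequentially"
      unfolding eventually_sequentially
      by (rule exI[of _ "Suc (to_nat_on D x)"]) (auto simp: g_def Dn_def True)
    then show ?thesis by (rule tendsto_eventually)
  next
    case False
    then have "x \<notin> Dn n" for n by (simp add: Dn_def)
    then have "(\<lambda>n. g n x) = (\<lambda>n. \<Psi> (embed_approx n x))" by (simp add: g_def)
    moreover have "(\<lambda>n. \<Psi> (embed_approx n x)) \<longlonglongrightarrow> \<Psi> (embed x)"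
      using continuous_on_tendsto_compose[OF \<Psi> embed_approx_tendsto] by simp
    ultimately show ?thesis using \<Phi>[OF False] by simp
  qed
  ultimately show ?thesis unfolding baire_class_2_def by blast
qed

theorem ex_continuous_action:
  "\<exists>(G :: nat monoid) \<phi> (\<Phi> :: (nat \<Rightarrow> bool) \<Rightarrow> (nat \<Rightarrow> nat)).
     group G \<and> continuous_action G \<phi> \<and> baire_class_2 \<Phi> \<and> bij \<Phi> \<and>
     (\<forall>x y. E x y \<longleftrightarrow> orbit_equiv G \<phi> (\<Phi> x) (\<Phi> y))"
proof -
  obtain \<Psi> :: "(nat \<Rightarrow> nat) \<Rightarrow> (nat \<Rightarrow> nat)" where \<Psi>: "continuous_on UNIV \<Psi>"
    "bij_betw \<Psi> (embed ` (- removed)) UNIV"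
    "\<And>x y n. x \<notin> removed \<Longrightarrow> y \<notin> removed \<Longrightarrow> agree n (\<Psi> (embed x)) (\<Psi> (embed y)) \<Longrightarrow>
      agree n (embed x) (embed y)"
    using ex_baire_coordinates by blast
  define \<kappa> where "\<kappa> = \<Psi> \<circ> embed"
  have bij: "bij_betw \<kappa> (- removed) UNIV"
    unfolding \<kappa>_def
    using inj_on_subset[OF inj_embed subset_UNIV] \<Psi>(2)
    by (intro bij_betw_trans[OF _ \<Psi>(2)]) (simp add: bij_betw_def)
  define \<mu> where "\<mu> = inv_into (- removed) \<kappa>"
  have \<mu>: "\<mu> v \<notin> removed" "\<kappa> (\<mu> v) = v" for v
    using bij_betw_apply[OF bij_betw_inv_into[OF bij], of v] bij_betw_inv_into_right[OF bij, of v]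
    by (simp_all add: \<mu>_def)
  have \<mu>\<kappa>: "\<mu> (\<kappa> x) = x" if "x \<notin> removed" for x
    using bij_betw_inv_into_left[OF bij, of x] that by (simp add: \<mu>_def)
  define swp where "swp j = (case from_nat j of (s, t, n, b) \<Rightarrow> swap s t n b)" for j
  have swp: "\<exists>s t n b. swp j = swap s t n b" for j
    by (cases "from_nat j :: 's \<times> 's \<times> nat \<times> bool") (auto simp: swp_def)
  have swp_keep: "swp j x \<notin> removed" if "x \<notin> removed" for j x
    using swp[of j] removed_invariant[OF E_swap, of x] that by auto
  \<comment> \<open>The swaps are transported to Baire space along \<open>\<kappa>\<close>; they
    preserve the retained points because these form a union of classes.\<close>
  define \<theta> where "\<theta> j = \<kappa> \<circ> swp j \<circ> \<mu>" for j
  have \<theta>\<kappa>: "\<theta> j (\<kappa> x) = \<kappa> (swp j x)" if "x \<notin> removed" for j x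
    using \<mu>\<kappa>[OF that] by (simp add: \<theta>_def)
  have inv: "\<theta> j (\<theta> j v) = v" for j v
  proof -
    have "\<theta> j (\<theta> j v) = \<kappa> (swp j (swp j (\<mu> v)))"
      using \<theta>\<kappa>[OF swp_keep[OF \<mu>(1)]] by (simp add: \<theta>_def)
    also have "swp j (swp j (\<mu> v)) = \<mu> v" using swp[of j] swap_swap by auto
    finally show ?thesis using \<mu>(2) by simp
  qed
  have cont: "continuous_on UNIV (\<theta> j)" for j
    unfolding continuous_on_UNIV_iff_agree
  proof (intro allI)
    fix v k
    define x where "x = \<mu> v"
    have x: "x \<notin> removed" "v = \<kappa> x" using \<mu> by (simp_all add: x_def)
    \<comment> \<open>The precision is chosen backwards from the target: for \<open>\<Psi>\<close>,
      for \<open>embed\<close> at the image point, then for \<open>refine\<close> at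
      \<open>x\<close>. Since \<open>refine\<close> occupies the even coordinates,
      \<open>2 * m3\<close> values of \<open>v\<close> suffice.\<close>
    obtain m1 where m1: "\<forall>u. agree m1 (embed (swp j x)) u \<longrightarrow> agree k (\<Psi> (embed (swp j x))) (\<Psi> u)"
      using \<Psi>(1) unfolding continuous_on_UNIV_iff_agree by blast
    obtain m2 where m2: "\<forall>y. agree m2 (refine (swp j x)) (refine y) \<longrightarrow>
        agree m1 (embed (swp j x)) (embed y)"
      using refine_determines_embed[OF swp_keep[OF x(1)]] by blast
    have "locally_determined (\<lambda>x. swp j x \<in> code_set c)" for c
      using swp[of j] locally_determined_swap by auto
    then obtain m3 where m3: "\<forall>y. agree m3 (refine x) (refine y) \<longrightarrow>
        agree m2 (refine (swp j x)) (refine (swp j y))"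
      using refine_continuous by blast
    have "agree k (\<theta> j v) (\<theta> j u)" if u: "agree (2 * m3) v u" for u
    proof -
      have "agree (2 * m3) (\<Psi> (embed x)) (\<Psi> (embed (\<mu> u)))"
        using u \<mu>(2)[of u] x(2) by (simp add: \<kappa>_def)
      then have "agree m3 (refine x) (refine (\<mu> u))"
        using \<Psi>(3)[OF x(1) \<mu>(1)] agree_refine_if_agree_embed by blast
      then have "agree k (\<Psi> (embed (swp j x))) (\<Psi> (embed (swp j (\<mu> u))))"
        using m1 m2 m3 by blast
      then show ?thesis by (simp add: \<theta>_def \<kappa>_def x_def)
    qed
    then show "\<exists>m. \<forall>u. agree m v u \<longrightarrow> agree k (\<theta> j v) (\<theta> j u)" by blast
  qed
  obtain G :: "nat monoid" and \<phi> where G: "group G" "continuous_action G \<phi>"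
    "\<And>u v. orbit_equiv G \<phi> u v \<longleftrightarrow> (\<exists>l. v = foldr \<theta> l u)"
    by (rule continuous_action_of_involutions[of \<theta>, OF inv cont]) blast+
  \<comment> \<open>Applying a word moves a retained point within its class; as
    \<open>\<kappa>\<close> is injective there, orbits cannot exceed classes.\<close>
  have word: "\<exists>y. y \<notin> removed \<and> E x y \<and> foldr \<theta> l (\<kappa> x) = \<kappa> y" if "x \<notin> removed" for l x
  proof (induction l)
    case Nil
    show ?case using that equivp_reflp[OF equivp] by auto
  next
    case (Cons j l)
    then obtain y where y: "y \<notin> removed" "E x y" "foldr \<theta> l (\<kappa> x) = \<kappa> y" by blast
    have "E y (swp j y)" using swp[of j] E_swap by auto
    then have "E x (swp j y)" using equivp_transp[OF equivp, of x y "swp j y"] y(2) by blast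
    then show ?case using y \<theta>\<kappa>[OF y(1), of j] swp_keep[OF y(1), of j] by auto
  qed
  have orbit: "E x y \<longleftrightarrow> orbit_equiv G \<phi> (\<kappa> x) (\<kappa> y)" if xy: "x \<notin> removed" "y \<notin> removed" for x y
  proof
    assume E: "E x y"
    have "\<exists>l. \<kappa> y = foldr \<theta> l (\<kappa> x)"
    proof (cases "x = y")
      case True
      then show ?thesis by (intro exI[of _ "[]"]) simp
    next
      case False
      then obtain s t n b where "y = swap s t n b x" using ex_swap E by blast
      then have "y = swp (to_nat (s, t, n, b)) x" by (simp add: swp_def)
      then show ?thesis using \<theta>\<kappa>[OF xy(1)] by (intro exI[of _ "[to_nat (s, t, n, b)]"]) simp
    qed
    then show "orbit_equiv G \<phi> (\<kappa> x) (\<kappa> y)" using G(3) by blast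
  next
    assume "orbit_equiv G \<phi> (\<kappa> x) (\<kappa> y)"
    then obtain l where "\<kappa> y = foldr \<theta> l (\<kappa> x)" using G(3) by blast
    moreover obtain y' where y': "y' \<notin> removed" "E x y'" "foldr \<theta> l (\<kappa> x) = \<kappa> y'"
      using word[OF xy(1)] by blast
    ultimately have "\<kappa> y = \<kappa> y'" by simp
    then have "y = y'" using \<mu>\<kappa>[OF xy(2)] \<mu>\<kappa>[OF y'(1)] by (metis (no_types))
    with y' show "E x y" by simp
  qed
  obtain \<sigma> D where \<sigma>: "bij_betw \<sigma> UNIV (- removed)" "\<And>x y. E (\<sigma> x) (\<sigma> y) \<longleftrightarrow> E x y"
    and D: "countable D" "\<And>x. x \<notin> D \<Longrightarrow> \<sigma> x = x"
    by (rule absorb_countably_many_classes[OF equivp infinite_class countable_class countable_removed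
        iffD1[OF removed_invariant] uncountable_retained]) blast+
  have \<sigma>_in: "\<sigma> x \<notin> removed" for x using bij_betw_apply[OF \<sigma>(1), of x] by simp
  \<comment> \<open>Outside the countable set \<open>D\<close> this is \<open>\<Psi>\<close> after
    \<open>embed\<close>, which is what the bound on the Baire class requires.\<close>
  define \<Phi> where "\<Phi> = \<kappa> \<circ> \<sigma>"
  have "bij \<Phi>" unfolding \<Phi>_def using \<sigma>(1) bij by (rule bij_betw_trans)
  moreover have "baire_class_2 \<Phi>"
    using \<Psi>(1) D(1) by (rule baire_class_2_modification) (simp add: \<Phi>_def \<kappa>_def D(2))
  moreover have "E x y \<longleftrightarrow> orbit_equiv G \<phi> (\<Phi> x) (\<Phi> y)" for x y
    using orbit[OF \<sigma>_in \<sigma>_in, of x y] \<sigma>(2) by (simp add: \<Phi>_def)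
  ultimately show ?thesis using G(1,2) by blast
qed

end

section \<open>Turing reducibility\<close>

instance oracle_term :: countable
  by countable_datatype

section \<open>Determinism and finite use of oracle computations\<close>

inductive_cases oracle_eval_ZeroE: "oracle_eval y Zero as v"
inductive_cases oracle_eval_SuccE: "oracle_eval y Succ as v"
inductive_cases oracle_eval_ProjE: "oracle_eval y (Proj i) as v"
inductive_cases oracle_eval_OracleE: "oracle_eval y Oracle as v"
inductive_cases oracle_eval_CompE: "oracle_eval y (Comp f gs) as v"
inductive_cases oracle_eval_PrimRec_0E: "oracle_eval y (PrimRec f g) (0 # as) v"
inductive_cases oracle_eval_PrimRec_SucE: "oracle_eval y (PrimRec f g) (Suc n # as) v"
inductive_cases oracle_eval_MuE: "oracle_eval y (Mu f) as v"

lemma oracle_eval_functional: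
  "oracle_eval y t as v \<Longrightarrow> oracle_eval y t as w \<Longrightarrow> v = w"
proof (induction arbitrary: w rule: oracle_eval.induct)
  case (Comp as gs bs f v)
  from Comp.prems obtain cs where cs: "list_all2 (\<lambda>g b. oracle_eval y g as b) gs cs"
    and w: "oracle_eval y f cs w"
    by (rule oracle_eval_CompE)
  have "bs = cs"
    using Comp.IH(1) cs by (auto simp: list_all2_conv_all_nth intro!: nth_equalityI)
  then show ?case using Comp.IH(2) w by blast
next
  case (PrimRec_0 f as v g)
  then show ?case by (blast elim: oracle_eval_PrimRec_0E)
next
  case (PrimRec_Suc f g n as u v)
  from PrimRec_Suc.prems obtain u' where "oracle_eval y (PrimRec f g) (n # as) u'"
    "oracle_eval y g (n # u' # as) w"
    by (rule oracle_eval_PrimRec_SucE)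
  then show ?case using PrimRec_Suc.IH by blast
next
  case (Mu f n as)
  from Mu.prems obtain w0: "oracle_eval y f (w # as) 0"
    and wi: "\<forall>i<w. \<exists>u>0. oracle_eval y f (i # as) u"
    by (rule oracle_eval_MuE)
  show ?case
  \<comment> \<open>If two search results differed, the body would be both zero and positive at the
    smaller one.\<close>
  proof (rule linorder_cases[of n w])
    assume "n < w"
    with wi obtain u where "u > 0" "oracle_eval y f (n # as) u" by blast
    then show ?thesis using Mu.IH(1) by fastforce
  next
    assume "w < n"
    with Mu.IH(2) w0 show ?thesis by fastforce
  qed
qed (auto elim: oracle_eval_ZeroE oracle_eval_SuccE oracle_eval_ProjE oracle_eval_OracleE)

text \<open>A derivation consults the oracle finitely often. Bounds for the parts of a computation
  are added up to bound the whole.\<close>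

lemma oracle_eval_use:
  "oracle_eval y t as v \<Longrightarrow> \<exists>N. \<forall>y'. (\<forall>i<N. y' i = y i) \<longrightarrow> oracle_eval y' t as v"
proof (induction rule: oracle_eval.induct)
  case (Zero as)
  then show ?case by (blast intro: oracle_eval.Zero)
next
  case (Succ n)
  then show ?case by (blast intro: oracle_eval.Succ)
next
  case (Proj i as)
  then show ?case by (blast intro: oracle_eval.Proj)
next
  case (Oracle n)
  show ?case
  proof (intro exI[of _ "Suc n"] allI impI)
    fix y' assume "\<forall>i<Suc n. y' i = y i"
    then have "y' n = y n" by simp
    then show "oracle_eval y' Oracle [n] (of_bool (y n))"
      using oracle_eval.Oracle[of y' n] by simp
  qed
next
  case (Comp as gs bs f v)
  then obtain N where N: "\<forall>y'. (\<forall>i<N. y' i = y i) \<longrightarrow> oracle_eval y' f bs v" by blast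
  have "\<exists>M. j < length gs \<longrightarrow> (\<forall>y'. (\<forall>i<M. y' i = y i) \<longrightarrow> oracle_eval y' (gs ! j) as (bs ! j))" for j
    using Comp.IH(1) by (auto simp: list_all2_conv_all_nth)
  then obtain M where M: "\<And>j y'. j < length gs \<Longrightarrow> (\<forall>i<M j. y' i = y i)
      \<Longrightarrow> oracle_eval y' (gs ! j) as (bs ! j)"
    by metis
  have le: "M j \<le> (\<Sum>k<length gs. M k)" if "j < length gs" for j
    using that by (intro member_le_sum) auto
  have "length gs = length bs"
    using Comp.IH(1) by (auto dest: list_all2_lengthD)
  show ?case
  proof (intro exI[of _ "N + (\<Sum>k<length gs. M k)"] allI impI)
    fix y' assume y': "\<forall>i<N + (\<Sum>k<length gs. M k). y' i = y i"
    have "list_all2 (\<lambda>g b. oracle_eval y' g as b) gs bs"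
      unfolding list_all2_conv_all_nth
    proof (intro conjI allI impI)
      fix j assume "j < length gs"
      then show "oracle_eval y' (gs ! j) as (bs ! j)"
        using y' le[of j] by (intro M) auto
    qed fact
    moreover have "oracle_eval y' f bs v" using N y' by simp
    ultimately show "oracle_eval y' (Comp f gs) as v" by (rule oracle_eval.Comp)
  qed
next
  case (PrimRec_0 f as v g)
  then show ?case by (blast intro: oracle_eval.PrimRec_0)
next
  case (PrimRec_Suc f g n as u v)
  then obtain N M where NM: "\<forall>y'. (\<forall>i<N. y' i = y i) \<longrightarrow> oracle_eval y' (PrimRec f g) (n # as) u"
    "\<forall>y'. (\<forall>i<M. y' i = y i) \<longrightarrow> oracle_eval y' g (n # u # as) v" by blast
  show ?case
  proof (intro exI[of _ "N + M"] allI impI)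
    fix y' assume "\<forall>i<N + M. y' i = y i"
    with NM have "oracle_eval y' (PrimRec f g) (n # as) u" "oracle_eval y' g (n # u # as) v"
      by simp_all
    then show "oracle_eval y' (PrimRec f g) (Suc n # as) v" by (rule oracle_eval.PrimRec_Suc)
  qed
next
  case (Mu f n as)
  then obtain N where N: "\<forall>y'. (\<forall>i<N. y' i = y i) \<longrightarrow> oracle_eval y' f (n # as) 0" by blast
  \<comment> \<open>The positive value and its bound depend on each other, so they are chosen
    together as a pair.\<close>
  have "\<forall>j\<in>{..<n}. \<exists>p. fst p > 0 \<and>
      (\<forall>y'. (\<forall>i<snd p. y' i = y i) \<longrightarrow> oracle_eval y' f (j # as) (fst p))"
  proof
    fix j assume "j \<in> {..<n}"
    then have "j < n" by simp
    from Mu.IH(2)[rule_format, OF this] obtain u M where "u > 0"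
      "\<forall>y'. (\<forall>i<M. y' i = y i) \<longrightarrow> oracle_eval y' f (j # as) u" by auto
    then show "\<exists>p. fst p > 0 \<and>
        (\<forall>y'. (\<forall>i<snd p. y' i = y i) \<longrightarrow> oracle_eval y' f (j # as) (fst p))"
      by (intro exI[of _ "(u, M)"]) simp
  qed
  from bchoice[OF this] obtain p where p: "\<forall>j\<in>{..<n}. fst (p j) > 0 \<and>
      (\<forall>y'. (\<forall>i<snd (p j). y' i = y i) \<longrightarrow> oracle_eval y' f (j # as) (fst (p j)))" ..
  define u M where "u j = fst (p j)" and "M j = snd (p j)" for j
  have M: "\<And>j. j < n \<Longrightarrow> u j > 0"
    "\<And>j y'. j < n \<Longrightarrow> (\<forall>i<M j. y' i = y i) \<Longrightarrow> oracle_eval y' f (j # as) (u j)"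
    using p by (simp_all add: u_def M_def)
  have le: "M j \<le> (\<Sum>k<n. M k)" if "j < n" for j
    using that by (intro member_le_sum) auto
  show ?case
  proof (intro exI[of _ "N + (\<Sum>k<n. M k)"] allI impI)
    fix y' assume y': "\<forall>i<N + (\<Sum>k<n. M k). y' i = y i"
    have "\<exists>u>0. oracle_eval y' f (j # as) u" if "j < n" for j
    proof (intro exI[of _ "u j"] conjI)
      show "oracle_eval y' f (j # as) (u j)"
        using y' le[OF that] by (intro M(2)[OF that]) simp
    qed (use M(1)[OF that] in simp)
    moreover have "oracle_eval y' f (n # as) 0" using N y' by simp
    ultimately show "oracle_eval y' (Mu f) as n" by (blast intro: oracle_eval.Mu)
  qed
qed

section \<open>Turing equivalence is an equivalence relation with infinite classes\<close>

primrec subst_oracle :: "oracle_term \<Rightarrow> oracle_term \<Rightarrow> oracle_term" where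
  "subst_oracle r Zero = Zero"
| "subst_oracle r Succ = Succ"
| "subst_oracle r (Proj i) = Proj i"
| "subst_oracle r Oracle = r"
| "subst_oracle r (Comp f gs) = Comp (subst_oracle r f) (map (subst_oracle r) gs)"
| "subst_oracle r (PrimRec f g) = PrimRec (subst_oracle r f) (subst_oracle r g)"
| "subst_oracle r (Mu f) = Mu (subst_oracle r f)"

text \<open>Each query is answered by running \<open>r\<close>, which makes reductions
  compose.\<close>

lemma oracle_eval_subst_oracle:
  assumes r: "\<And>n. oracle_eval z r [n] (of_bool (y n))"
  shows "oracle_eval y t as v \<Longrightarrow> oracle_eval z (subst_oracle r t) as v"
proof (induction rule: oracle_eval.induct)
  case (Comp as gs bs f v)
  then have "list_all2 (\<lambda>g b. oracle_eval z g as b) (map (subst_oracle r) gs) bs"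
    by (auto simp: list_all2_conv_all_nth)
  with Comp show ?case by (auto intro: oracle_eval.Comp)
next
  case (Oracle n)
  show ?case using r by simp
qed (auto intro: oracle_eval.intros)

lemma turing_reducible_refl: "x \<le>\<^sub>T x"
  unfolding turing_reducible_def by (blast intro: oracle_eval.Oracle)

lemma turing_reducible_trans: "x \<le>\<^sub>T y \<Longrightarrow> y \<le>\<^sub>T z \<Longrightarrow> x \<le>\<^sub>T z"
proof -
  assume "x \<le>\<^sub>T y" "y \<le>\<^sub>T z"
  then obtain t r where t: "\<And>n. oracle_eval y t [n] (of_bool (x n))"
    and r: "\<And>n. oracle_eval z r [n] (of_bool (y n))"
    unfolding turing_reducible_def by blast
  from oracle_eval_subst_oracle[OF r t] show "x \<le>\<^sub>T z"
    unfolding turing_reducible_def by blast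
qed

lemma equivp_turing_equivalent: "equivp (\<equiv>\<^sub>T)"
proof (rule equivpI)
  show "reflp (\<equiv>\<^sub>T)"
    by (simp add: reflp_def turing_equivalent_def turing_reducible_refl)
  show "symp (\<equiv>\<^sub>T)"
    by (simp add: symp_def turing_equivalent_def)
  show "transp (\<equiv>\<^sub>T)"
    unfolding transp_def turing_equivalent_def by (meson turing_reducible_trans)
qed

lemma turing_equivalent_case_nat: "case_nat b x \<equiv>\<^sub>T x"
proof -
  \<comment> \<open>The base case of a unary primitive recursion is evaluated at the empty argument
    list, so a constant of arity 0 is wanted.\<close>
  define c where "c = (if b then Comp Succ [Zero] else Zero)"
  have c: "oracle_eval x c [] (of_bool b)"
  proof (cases b)
    case True
    then show ?thesis
      unfolding c_def using oracle_eval.Comp[of x "[]" "[Zero]" "[0]" Succ 1] 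
      by (auto intro: oracle_eval.Zero) (metis One_nat_def oracle_eval.Succ oracle_eval.Zero)
  next
    case False
    then show ?thesis unfolding c_def by (simp add: oracle_eval.Zero)
  qed
  \<comment> \<open>The recursion serves only as a case distinction: its step reads bit
    \<open>n\<close> of the oracle, whatever the previous value.\<close>
  have step: "oracle_eval x (Comp Oracle [Proj 0]) (n # as) (of_bool (x n))" for n as
    using oracle_eval.Comp[of x "n # as" "[Proj 0]" "[n]" Oracle] oracle_eval.Proj[of 0 "n # as"]
    by (simp add: oracle_eval.Oracle)
  have "oracle_eval x (PrimRec c (Comp Oracle [Proj 0])) [n] (of_bool (case_nat b x n))" for n
  proof (induction n)
    case 0
    show ?case using c by (simp add: oracle_eval.PrimRec_0)
  next
    case (Suc n)
    then show ?case using oracle_eval.PrimRec_Suc[OF Suc step] by simp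
  qed
  moreover have "oracle_eval (case_nat b x) (Comp Oracle [Succ]) [n] (of_bool (x n))" for n
    using oracle_eval.Comp[of "case_nat b x" "[n]" "[Succ]" "[Suc n]" Oracle]
      oracle_eval.Oracle[of "case_nat b x" "Suc n"]
    by (simp add: oracle_eval.Succ)
  ultimately show ?thesis
    unfolding turing_equivalent_def turing_reducible_def by blast
qed

text \<open>Prepending \<open>True\<close> is an injection of the degree into itself. On a finite
  degree it would be onto, but it misses every sequence that starts with
  \<open>False\<close>.\<close>

lemma infinite_turing_degree: "infinite {y. x \<equiv>\<^sub>T y}"
proof
  assume fin: "finite {y. x \<equiv>\<^sub>T y}" (is "finite ?C")
  have inj: "inj_on (case_nat b) ?C" for b
    by (auto simp: inj_on_def fun_eq_iff split: nat.splits)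
  have sub: "case_nat b ` ?C \<subseteq> ?C" for b
    using turing_equivalent_case_nat[of b] equivp_symp[OF equivp_turing_equivalent]
      equivp_transp[OF equivp_turing_equivalent] by blast
  have "case_nat True ` ?C = ?C"
    using card_subset_eq[OF fin sub] inj by (simp add: card_image)
  moreover have "case_nat False x \<in> ?C"
    using sub[of False] equivp_reflp[OF equivp_turing_equivalent] by auto
  ultimately obtain z where "case_nat False x = case_nat True z" by blast
  from fun_cong[OF this, of 0] show False by simp
qed

section \<open>Programs as continuous partial maps with G-delta domains\<close>

definition computes :: "oracle_term \<Rightarrow> (nat \<Rightarrow> bool) \<Rightarrow> (nat \<Rightarrow> bool) \<Rightarrow> bool" where
  "computes t y x \<longleftrightarrow> (\<forall>n. oracle_eval y t [n] (of_bool (x n)))"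

lemma computes_functional: "computes t y x \<Longrightarrow> computes t y x' \<Longrightarrow> x = x'"
proof
  fix n
  assume "computes t y x" "computes t y x'"
  then have "(of_bool (x n) :: nat) = of_bool (x' n)"
    unfolding computes_def by (intro oracle_eval_functional) blast+
  then show "x n = x' n" by (simp only: of_bool_eq_iff)
qed

definition computes_dom :: "oracle_term \<Rightarrow> (nat \<Rightarrow> bool) set" where
  "computes_dom t = {y. \<exists>x. computes t y x}"

definition computed :: "oracle_term \<Rightarrow> (nat \<Rightarrow> bool) \<Rightarrow> (nat \<Rightarrow> bool)" where
  "computed t y = (THE x. computes t y x)"

lemma computed_eq: "computes t y x \<Longrightarrow> computed t y = x"
  unfolding computed_def using computes_functional by blast

lemma open_oracle_eval: "open {y. oracle_eval y t as v}"
  unfolding open_iff_agree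
proof
  fix y assume "y \<in> {y. oracle_eval y t as v}"
  then obtain N where "\<forall>y'. (\<forall>i<N. y' i = y i) \<longrightarrow> oracle_eval y' t as v"
    using oracle_eval_use by blast
  then show "\<exists>n. \<forall>y'. agree n y y' \<longrightarrow> y' \<in> {y. oracle_eval y t as v}"
    by (intro exI[of _ N]) (simp add: agree_def)
qed

text \<open>For each argument, halting with a bit as output is an open condition on the oracle by
  finite use; the domain imposes countably many of these.\<close>

lemma gdelta_in_computes_dom: "gdelta_in euclidean (computes_dom t)"
proof -
  have "computes_dom t = (\<Inter>n. \<Union>b. {y. oracle_eval y t [n] (of_bool b)})" (is "_ = \<Inter> (range ?U)")
  proof (intro equalityI subsetI)
    fix y assume "y \<in> computes_dom t"
    then show "y \<in> \<Inter> (range ?U)" by (auto simp only: computes_dom_def computes_def)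
  next
    fix y assume "y \<in> \<Inter> (range ?U)"
    then have "\<forall>n. \<exists>b. oracle_eval y t [n] (of_bool b)" by blast
    then obtain x where "\<forall>n. oracle_eval y t [n] (of_bool (x n))" by metis
    then show "y \<in> computes_dom t" by (auto simp only: computes_dom_def computes_def)
  qed
  then show ?thesis
    using open_oracle_eval
    by (simp only:) (rule gdelta_in_Inter, auto intro!: open_imp_gdelta_in open_UN)
qed

lemma continuous_on_computed: "continuous_on (computes_dom t) (computed t)"
proof (rule continuous_on_coordinatewise_then_product)
  fix n
  show "continuous_on (computes_dom t) (\<lambda>y. computed t y n)"
    unfolding continuous_on_open_invariant
  proof (intro allI impI)
    fix B :: "bool set"
    have "(\<lambda>y. computed t y n) -` B \<inter> computes_dom t =
        (\<Union>b\<in>B. {y. oracle_eval y t [n] (of_bool b)}) \<inter> computes_dom t"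
    proof -
      have "computed t y n = b \<longleftrightarrow> oracle_eval y t [n] (of_bool b)" if y: "y \<in> computes_dom t" for y b
      proof -
        obtain x where x: "computes t y x" using y by (auto simp: computes_dom_def)
        then have "oracle_eval y t [n] (of_bool (x n))" by (simp add: computes_def)
        then show ?thesis using computed_eq[OF x] oracle_eval_functional[of y t "[n]"]
          by (metis of_bool_eq_iff)
      qed
      then show ?thesis by auto
    qed
    then show "\<exists>V. open V \<and> V \<inter> computes_dom t = (\<lambda>y. computed t y n) -` B \<inter> computes_dom t"
      using open_oracle_eval by (intro exI conjI) (auto intro!: open_UN)
  qed
qed

text \<open>A program is paired with a program for its inverse, so that exchanging \<open>s\<close>
  and \<open>t\<close> gives the inverse partial map within the same family.\<close>

definition mutual_dom :: "oracle_term \<Rightarrow> oracle_term \<Rightarrow> (nat \<Rightarrow> bool) set" where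
  "mutual_dom s t = {x. \<exists>y. computes s x y \<and> computes t y x}"

text \<open>These are the fixed points of the continuous partial map that runs \<open>s\<close> and
  then \<open>t\<close>; its domain \<open>D\<close> is G-delta, and being fixed is a G-delta
  condition on it.\<close>

lemma gdelta_in_mutual_dom: "gdelta_in euclidean (mutual_dom s t)"
proof -
  define D where "D = {x \<in> computes_dom s. computed s x \<in> computes_dom t}"
  define h where "h x = computed t (computed s x)" for x
  have gD: "gdelta_in euclidean D"
    unfolding D_def
    by (rule gdelta_in_continuous_preimage[OF gdelta_in_computes_dom continuous_on_computed
          gdelta_in_computes_dom])
  have h: "continuous_on D h"
    unfolding h_def
    by (rule continuous_on_compose2[OF continuous_on_computed[of t]
          continuous_on_subset[OF continuous_on_computed[of s]]]) (auto simp: D_def)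
  have pre: "gdelta_in euclidean ({x \<in> D. h x \<in> U} \<inter> U)" if "open U" for U
    using gdelta_in_continuous_preimage[OF gD h, of U] that
    by (intro gdelta_in_Int) (simp_all add: open_imp_gdelta_in)
  have "mutual_dom s t = {x \<in> D. h x = x}"
  proof (intro equalityI subsetI)
    fix x assume "x \<in> mutual_dom s t"
    then obtain y where y: "computes s x y" "computes t y x" by (auto simp: mutual_dom_def)
    then show "x \<in> {x \<in> D. h x = x}"
      using computed_eq[OF y(1)] computed_eq[OF y(2)] by (auto simp: D_def h_def computes_dom_def)
  next
    fix x assume x: "x \<in> {x \<in> D. h x = x}"
    then obtain y z where yz: "computes s x y" "computes t (computed s x) z"
      by (auto simp: D_def computes_dom_def)
    then show "x \<in> mutual_dom s t"
      using x computed_eq[OF yz(1)] computed_eq[OF yz(2)] by (auto simp: mutual_dom_def h_def)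
  qed
  \<comment> \<open>Equality is split into countably many conditions, one for each bit, which is
    either true at both points or false at both.\<close>
  also have "\<dots> = (\<Inter>n. ({x \<in> D. h x \<in> {u. u n}} \<inter> {u. u n}) \<union>
      ({x \<in> D. h x \<in> - {u. u n}} \<inter> - {u. u n}))"
    by (auto simp: fun_eq_iff)
  also have "gdelta_in euclidean \<dots>"
    by (rule gdelta_in_Inter) (use clopen_bit in \<open>auto intro!: gdelta_in_Un pre simp del: mem_Collect_eq Compl_iff\<close>)
  finally show ?thesis .
qed

interpretation turing: partial_homeomorphisms mutual_dom "\<lambda>s t. computed s" "(\<equiv>\<^sub>T)"
proof
  fix s t x y
  show "gdelta_in euclidean (mutual_dom s t)" by (rule gdelta_in_mutual_dom)
  have "mutual_dom s t \<subseteq> computes_dom s" by (auto simp: mutual_dom_def computes_dom_def)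
  then show "continuous_on (mutual_dom s t) (computed s)"
    by (rule continuous_on_subset[OF continuous_on_computed])
  show "computed s x \<in> mutual_dom t s" "computed t (computed s x) = x" if "x \<in> mutual_dom s t"
    using that computed_eq by (auto simp: mutual_dom_def)
  have "x \<equiv>\<^sub>T y \<longleftrightarrow> (\<exists>s t. computes s x y \<and> computes t y x)"
    unfolding turing_equivalent_def turing_reducible_def computes_def by blast
  also have "\<dots> \<longleftrightarrow> (\<exists>s t. x \<in> mutual_dom s t \<and> y = computed s x)"
    unfolding mutual_dom_def using computed_eq by blast
  finally show "x \<equiv>\<^sub>T y \<longleftrightarrow> (\<exists>s t. x \<in> mutual_dom s t \<and> y = computed s x)" .
  show "equivp (\<equiv>\<^sub>T)" by (rule equivp_turing_equivalent)
  show "infinite (Collect ((\<equiv>\<^sub>T) x))" using infinite_turing_degree[of x] by simp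
qed

theorem theorem3p34:
  shows "\<exists>(G :: nat monoid) (\<phi> :: nat \<Rightarrow> (nat \<Rightarrow> nat) \<Rightarrow> (nat \<Rightarrow> nat))
      (\<Phi> :: (nat \<Rightarrow> bool) \<Rightarrow> (nat \<Rightarrow> nat)).
    group G \<and> countable (carrier G) \<and> continuous_action G \<phi> \<and>
    baire_class_2 \<Phi> \<and> bij \<Phi> \<and>
    (\<forall>x y. x \<equiv>\<^sub>T y \<longleftrightarrow> orbit_equiv G \<phi> (\<Phi> x) (\<Phi> y))"
  using turing.ex_continuous_action by auto

end
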